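(* Let $F=(F_n)_{n\in\mathbb{N}}$ be a linear-like semiring family of graphs, and let $\eta_F$, $\eta_{F,f}$, $\eta_{F,\infty}$ be the $F$-number, fractional $F$-number and asymptotic $F$-number, regarded as functions on finite graphs. Then: (1) Each $\eta\in\{\eta_F,\eta_{F,f},\eta_{F,\infty}\}$ is monotone under graph homomorphisms (if $G\to H$ then $\eta(G)\le\eta(H)$), subadditive under joins ($\eta(G+H)\le\eta(G)+\eta(H)$), and submultiplicative under both lexicographic and disjunctive products ($\eta(G\ltimes H)\le\eta(G)\eta(H)$ and $\eta(G\ast H)\le\eta(G)\eta(H)$), for all finite graphs $G,H$. (2) For $\eta_F$, subadditivity holds with equality: $\eta_F(G+H)=\eta_F(G)+\eta_F(H)$. (3) For $\eta_{F,f}$, subadditivity and both forms of submultiplicativity hold with equality: $\eta_{F,f}(G+H)=\eta_{F,f}(G)+\eta_{F,f}(H)$, $\eta_{F,f}(G\ltimes H)=\eta_{F,f}(G)\eta_{F,f}(H)$, $\eta_{F,f}(G\ast H)=\eta_{F,f}(G)\eta_{F,f}(H)$. In particular, $\eta_{F,f}$ is a semiring-homomorphic graph invariant. (4) For every finite graph $G$, $\eta_{F,f}(G)\le \eta_{F,\infty}(G)\le\eta_F(G)$. (5) For every $n\in\mathbb{N}$, all three invariants take the value $n$ on the complete graph $K_n$.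
   Context: Graphs are undirected simple graphs $G=(V(G),E(G))$, possibly infinite; adjacency is written $v\sim w$. A graph homomorphism $G\to H$ is a map $V(G)\to V(H)$ sending adjacent vertices to adjacent vertices; "$G\to H$" also denotes the existence of one. The join $G+H$ has vertex set $V(G)\sqcup V(H)$, the edges of $G$ and of $H$, and every vertex of $G$ adjacent to every vertex of $H$. The disjunctive product $G\ast H$ has vertex set $V(G)\times V(H)$ with $(v,w)\sim(v',w')$ iff $v\sim v'$ or $w\sim w'$. The lexicographic product $G\ltimes H$ has vertex set $V(G)\times V(H)$ with $(v,w)\sim(v',w')$ iff $v\sim v'$, or $v=v'$ and $w\sim w'$. $G^{\ast n}$ is the $n$-fold disjunctive power. $K_n$ is the complete graph on $n$ vertices ($K_0=\emptyset$), $\omega$ the clique number. A $d$-clique is a set of $d$ pairwise adjacent vertices. For $d\in\mathbb{N}_+$, the $d$-fractionalization $G/d$ is the graph whose vertices are the $d$-cliques of $G$, with $S\sim T$ iff $S\cap T=\emptyset$ and $s\sim t$ for all $s\in S$, $t\in T$. A semiring family is a sequence of graphs $(F_n)_{n\in\mathbb{N}}$ with $F_0=\emptyset$, $F_1\neq\emptyset$, and $F_n+F_m\to F_{n+m}$ and $F_n\ast F_m\to F_{nm}$ for all $n,m\in\mathbb{N}$. For a finite graph $G$: the $F$-number is $\eta_F(G)=\min\{n\in\mathbb{N}: G\to F_n\}$; the fractional $F$-number is $\eta_{F,f}(G)=\inf\{n/d: n\in\mathbb{N}, d\in\mathbb{N}_+, G\to F_n/d\}$; the asymptotic $F$-number is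 $\eta_{F,\infty}(G)=\inf_{n\ge1}\sqrt[n]{\eta_F(G^{\ast n})}$. For $S\subseteq V(G)$, $S^\perp$ is the set of vertices adjacent to every vertex of $S$; $S$ is a flat if $S^{\perp\perp}=S$; the rank of $S$ is $\mathrm{rk}(S)=\omega(S^{\perp\perp})$ (clique number of the induced subgraph on $S^{\perp\perp}$). A sequence $(F_n)$ is linear-like if for every $n$ and every flat $S\subseteq V(F_n)$, the induced subgraph of $F_n$ on $S$ is homomorphically equivalent (homomorphisms in both directions) to $F_{\mathrm{rk}(S)}$. A semiring-homomorphic graph invariant is a map $\eta$ from (isomorphism classes of) finite graphs to $\mathbb{R}_{\ge0}$ with $\eta(K_1)=1$, $\eta(G)\le\eta(H)$ whenever $G\to H$, $\eta(G+H)=\eta(G)+\eta(H)$ and $\eta(G\ast H)=\eta(G)\eta(H)$. *)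

theory Defs
  imports Complex_Main "HOL-Library.Extended_Nat" "HOL-Library.FuncSet"
begin

record 'a ugraph =
  verts :: "'a set"
  adj :: "'a \<Rightarrow> 'a \<Rightarrow> bool"

definition simple_graph :: "'a ugraph \<Rightarrow> bool" where
  "simple_graph G \<longleftrightarrow>
     (\<forall>v w. adj G v w \<longrightarrow> v \<in> verts G \<and> w \<in> verts G \<and> v \<noteq> w \<and> adj G w v)"

definition finite_graph :: "'a ugraph \<Rightarrow> bool" where
  "finite_graph G \<longleftrightarrow> simple_graph G \<and> finite (verts G)"

definition graph_hom :: "'a ugraph \<Rightarrow> 'b ugraph \<Rightarrow> ('a \<Rightarrow> 'b) \<Rightarrow> bool" where
  "graph_hom G H f \<longleftrightarrow>
     f \<in> verts G \<rightarrow> verts H \<and>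
     (\<forall>v\<in>verts G. \<forall>w\<in>verts G. adj G v w \<longrightarrow> adj H (f v) (f w))"

definition hom_to :: "'a ugraph \<Rightarrow> 'b ugraph \<Rightarrow> bool"  (infix "\<rightarrow>\<^sub>g" 50) where
  "G \<rightarrow>\<^sub>g H \<longleftrightarrow> (\<exists>f. graph_hom G H f)"

definition hom_equiv :: "'a ugraph \<Rightarrow> 'b ugraph \<Rightarrow> bool" where
  "hom_equiv G H \<longleftrightarrow> G \<rightarrow>\<^sub>g H \<and> H \<rightarrow>\<^sub>g G"

definition graph_iso :: "'a ugraph \<Rightarrow> 'b ugraph \<Rightarrow> bool" where
  "graph_iso G H \<longleftrightarrow>
     (\<exists>f. bij_betw f (verts G) (verts H) \<and>
          (\<forall>v\<in>verts G. \<forall>w\<in>verts G. adj G v w \<longleftrightarrow> adj H (f v) (f w)))"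

definition induced :: "'a ugraph \<Rightarrow> 'a set \<Rightarrow> 'a ugraph" where
  "induced G S =
     \<lparr>verts = verts G \<inter> S, adj = (\<lambda>v w. v \<in> S \<and> w \<in> S \<and> adj G v w)\<rparr>"

definition complete_graph :: "nat \<Rightarrow> nat ugraph" where
  "complete_graph n =
     \<lparr>verts = {..<n}, adj = (\<lambda>v w. v < n \<and> w < n \<and> v \<noteq> w)\<rparr>"

definition graph_join :: "'a ugraph \<Rightarrow> 'b ugraph \<Rightarrow> ('a + 'b) ugraph" where
  "graph_join G H =
     \<lparr>verts = verts G <+> verts H,
      adj = (\<lambda>x y. case (x, y) of
               (Inl v, Inl v') \<Rightarrow> adj G v v'
             | (Inr w, Inr w') \<Rightarrow> adj H w w'
             | (Inl v, Inr w) \<Rightarrow> v \<in> verts G \<and> w \<in> verts H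
             | (Inr w, Inl v) \<Rightarrow> v \<in> verts G \<and> w \<in> verts H)\<rparr>"

definition disj_prod :: "'a ugraph \<Rightarrow> 'b ugraph \<Rightarrow> ('a \<times> 'b) ugraph" where
  "disj_prod G H =
     \<lparr>verts = verts G \<times> verts H,
      adj = (\<lambda>(v, w) (v', w').
               (v, w) \<in> verts G \<times> verts H \<and> (v', w') \<in> verts G \<times> verts H \<and>
               (adj G v v' \<or> adj H w w'))\<rparr>"

definition lex_prod_graph :: "'a ugraph \<Rightarrow> 'b ugraph \<Rightarrow> ('a \<times> 'b) ugraph" where
  "lex_prod_graph G H =
     \<lparr>verts = verts G \<times> verts H,
      adj = (\<lambda>(v, w) (v', w').
               (v, w) \<in> verts G \<times> verts H \<and> (v', w') \<in> verts G \<times> verts H \<and>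
               (adj G v v' \<or> v = v' \<and> adj H w w'))\<rparr>"

text \<open>Vertices of the \<open>n\<close>-fold disjunctive power are \<open>n\<close>-tuples, encoded as lists of length \<open>n\<close>.\<close>

definition disj_power :: "'a ugraph \<Rightarrow> nat \<Rightarrow> 'a list ugraph" where
  "disj_power G n =
     (let V = {xs. length xs = n \<and> set xs \<subseteq> verts G}
      in \<lparr>verts = V,
          adj = (\<lambda>xs ys. xs \<in> V \<and> ys \<in> V \<and> (\<exists>i<n. adj G (xs ! i) (ys ! i)))\<rparr>)"

definition is_clique :: "'a ugraph \<Rightarrow> nat \<Rightarrow> 'a set \<Rightarrow> bool" where
  "is_clique G d S \<longleftrightarrow>
     S \<subseteq> verts G \<and> finite S \<and> card S = d \<and>
     (\<forall>v\<in>S. \<forall>w\<in>S. v \<noteq> w \<longrightarrow> adj G v w)"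

text \<open>An infinite graph may have arbitrarily large cliques, so the clique number is extended.\<close>

definition clique_number :: "'a ugraph \<Rightarrow> enat" where
  "clique_number G = Sup {enat d | d. \<exists>S. is_clique G d S}"

text \<open>Only meant for \<open>d > 0\<close>: for \<open>d = 0\<close> the empty clique would carry a loop.\<close>

definition fractionalization :: "'a ugraph \<Rightarrow> nat \<Rightarrow> 'a set ugraph" where
  "fractionalization G d =
     \<lparr>verts = {S. is_clique G d S},
      adj = (\<lambda>S T. is_clique G d S \<and> is_clique G d T \<and> S \<inter> T = {} \<and>
                   (\<forall>s\<in>S. \<forall>t\<in>T. adj G s t))\<rparr>"

definition perp :: "'a ugraph \<Rightarrow> 'a set \<Rightarrow> 'a set" where
  "perp G S = {v \<in> verts G. \<forall>s\<in>S. adj G v s}"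

definition is_flat :: "'a ugraph \<Rightarrow> 'a set \<Rightarrow> bool" where
  "is_flat G S \<longleftrightarrow> S \<subseteq> verts G \<and> perp G (perp G S) = S"

definition flat_rank :: "'a ugraph \<Rightarrow> 'a set \<Rightarrow> enat" where
  "flat_rank G S = clique_number (induced G (perp G (perp G S)))"

definition semiring_family :: "(nat \<Rightarrow> 'f ugraph) \<Rightarrow> bool" where
  "semiring_family F \<longleftrightarrow>
     (\<forall>n. simple_graph (F n)) \<and>
     verts (F 0) = {} \<and> verts (F 1) \<noteq> {} \<and>
     (\<forall>n m. graph_join (F n) (F m) \<rightarrow>\<^sub>g F (n + m)) \<and>
     (\<forall>n m. disj_prod (F n) (F m) \<rightarrow>\<^sub>g F (n * m))"

text \<open>The family is indexed by natural numbers only, so being equivalent to the member at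
  index \<open>flat_rank (F n) S\<close> includes that this rank is finite.\<close>

definition linear_like :: "(nat \<Rightarrow> 'f ugraph) \<Rightarrow> bool" where
  "linear_like F \<longleftrightarrow>
     (\<forall>n S. is_flat (F n) S \<longrightarrow>
        (\<exists>k. flat_rank (F n) S = enat k \<and> hom_equiv (induced (F n) S) (F k)))"

text \<open>For a semiring family and a finite graph \<open>G\<close>, the sets over which the minimum and the
  infima below are taken are nonempty: \<open>G\<close> maps to the complete graph on its vertices, which
  maps to \<open>F (card (verts G))\<close>.\<close>

definition F_number :: "(nat \<Rightarrow> 'f ugraph) \<Rightarrow> 'a ugraph \<Rightarrow> nat" where
  "F_number F G = (LEAST n. G \<rightarrow>\<^sub>g F n)"

definition frac_F_number :: "(nat \<Rightarrow> 'f ugraph) \<Rightarrow> 'a ugraph \<Rightarrow> real" where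
  "frac_F_number F G =
     Inf {real n / real d | n d. d > 0 \<and> G \<rightarrow>\<^sub>g fractionalization (F n) d}"

definition asymp_F_number :: "(nat \<Rightarrow> 'f ugraph) \<Rightarrow> 'a ugraph \<Rightarrow> real" where
  "asymp_F_number F G =
     (INF n\<in>{1..}. root n (real (F_number F (disj_power G n))))"

text \<open>A map on isomorphism classes of finite graphs is given by an isomorphism-invariant function
  on the finite graphs with vertices in \<open>nat\<close>, which represent all classes. Joins and products
  leave this type, hence they are represented by arbitrary isomorphic copies \<open>J\<close>.\<close>

definition semiring_homomorphic :: "(nat ugraph \<Rightarrow> real) \<Rightarrow> bool" where
  "semiring_homomorphic \<eta> \<longleftrightarrow>
     (\<forall>G. finite_graph G \<longrightarrow> \<eta> G \<ge> 0) \<and>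
     (\<forall>G H. finite_graph G \<and> finite_graph H \<and> graph_iso G H \<longrightarrow> \<eta> G = \<eta> H) \<and>
     \<eta> (complete_graph 1) = 1 \<and>
     (\<forall>G H. finite_graph G \<and> finite_graph H \<and> G \<rightarrow>\<^sub>g H \<longrightarrow> \<eta> G \<le> \<eta> H) \<and>
     (\<forall>G H J. finite_graph G \<and> finite_graph H \<and> finite_graph J \<and>
        graph_iso J (graph_join G H) \<longrightarrow> \<eta> J = \<eta> G + \<eta> H) \<and>
     (\<forall>G H J. finite_graph G \<and> finite_graph H \<and> finite_graph J \<and>
        graph_iso J (disj_prod G H) \<longrightarrow> \<eta> J = \<eta> G * \<eta> H)"

end

(* The double perp of a clique C inside a maximum clique of F n is a flat of rank |C|, so linear-likeness
   forces the clique number of F n to be n. The perps of two orthogonal sets are orthogonal flats, and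
   a join of cliques of their ranks fits into F n: this gives superadditivity. A homomorphism
   G -> F n / d is the same as one from the lexicographic product of G and K d to F n. If the
   lexicographic product of G and H maps to F n, the flats spanned by the images of the copies of H
   have rank at least the F-number m of H and are orthogonal over adjacent vertices of G, so choosing
   m-cliques in them gives G -> F n / m; this is supermultiplicativity of the fractional number,
   which applied to powers bounds the asymptotic number from below. *)

theory Submission
  imports Defs
begin

section \<open>Homomorphisms\<close>

text \<open>Subadditivity of the asymptotic number is where composing homomorphisms does not
  suffice. A power of a join is a binomial sum of products of powers of \<open>G\<close> and of
  \<open>H\<close>, so it involves all exponents at once, while a value close to an asymptotic
  number is only known to occur at a single exponent. Submultiplicativity of \<open>F_number\<close>
  along powers therefore has to be converted into bounds \<open>C * x ^ k\<close> valid for every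
  \<open>k\<close>, with \<open>x\<close> any number above the asymptotic one. The binomial sum then
  collapses to \<open>(x + y) ^ n\<close>, and the constants disappear under the \<open>n\<close>-th
  root.\<close>

lemma hom_toI:
  assumes "\<And>v. v \<in> verts G \<Longrightarrow> f v \<in> verts H"
    and "\<And>v w. v \<in> verts G \<Longrightarrow> w \<in> verts G \<Longrightarrow> adj G v w \<Longrightarrow> adj H (f v) (f w)"
  shows "G \<rightarrow>\<^sub>g H"
  using assms unfolding hom_to_def graph_hom_def by blast

lemma hom_toE:
  assumes "G \<rightarrow>\<^sub>g H"
  obtains f where "\<And>v. v \<in> verts G \<Longrightarrow> f v \<in> verts H"
    and "\<And>v w. v \<in> verts G \<Longrightarrow> w \<in> verts G \<Longrightarrow> adj G v w \<Longrightarrow> adj H (f v) (f w)"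
  using assms unfolding hom_to_def graph_hom_def by blast

lemma graph_homD:
  assumes "graph_hom G H f"
  shows "v \<in> verts G \<Longrightarrow> f v \<in> verts H"
    and "v \<in> verts G \<Longrightarrow> w \<in> verts G \<Longrightarrow> adj G v w \<Longrightarrow> adj H (f v) (f w)"
  using assms unfolding graph_hom_def by auto

lemma hom_to_trans:
  assumes "G \<rightarrow>\<^sub>g H" "H \<rightarrow>\<^sub>g K"
  shows "G \<rightarrow>\<^sub>g K"
proof -
  obtain f where f: "\<And>v. v \<in> verts G \<Longrightarrow> f v \<in> verts H"
    "\<And>v w. v \<in> verts G \<Longrightarrow> w \<in> verts G \<Longrightarrow> adj G v w \<Longrightarrow> adj H (f v) (f w)"
    using assms(1) by (rule hom_toE) blast
  obtain g where g: "\<And>v. v \<in> verts H \<Longrightarrow> g v \<in> verts K"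
    "\<And>v w. v \<in> verts H \<Longrightarrow> w \<in> verts H \<Longrightarrow> adj H v w \<Longrightarrow> adj K (g v) (g w)"
    using assms(2) by (rule hom_toE) blast
  show ?thesis
    by (rule hom_toI[of _ "\<lambda>v. g (f v)"]) (use f g in auto)
qed

lemma graph_iso_imp_hom:
  assumes "graph_iso G H"
  shows "G \<rightarrow>\<^sub>g H" "H \<rightarrow>\<^sub>g G"
proof -
  obtain f where f: "bij_betw f (verts G) (verts H)"
    "\<forall>v\<in>verts G. \<forall>w\<in>verts G. adj G v w \<longleftrightarrow> adj H (f v) (f w)"
    using assms unfolding graph_iso_def by blast
  show "G \<rightarrow>\<^sub>g H"
    by (rule hom_toI[of _ f]) (use f in \<open>auto simp: bij_betw_def\<close>)
  have inv: "inv_into (verts G) f v \<in> verts G" "f (inv_into (verts G) f v) = v"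
    if "v \<in> verts H" for v
    using f(1) that by (auto simp: bij_betw_def intro: inv_into_into f_inv_into_f)
  show "H \<rightarrow>\<^sub>g G"
    by (rule hom_toI[of _ "inv_into (verts G) f"]) (use f(2) inv in auto)
qed

section \<open>Vertices and edges of joins, products and powers\<close>

lemma verts_join [simp]: "verts (graph_join G H) = verts G <+> verts H"
  by (simp add: graph_join_def)

lemma adj_join [simp]:
  "adj (graph_join G H) (Inl v) (Inl v') \<longleftrightarrow> adj G v v'"
  "adj (graph_join G H) (Inr w) (Inr w') \<longleftrightarrow> adj H w w'"
  "adj (graph_join G H) (Inl v) (Inr w) \<longleftrightarrow> v \<in> verts G \<and> w \<in> verts H"
  "adj (graph_join G H) (Inr w) (Inl v) \<longleftrightarrow> v \<in> verts G \<and> w \<in> verts H"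
  by (simp_all add: graph_join_def)

lemma verts_disj [simp]: "verts (disj_prod G H) = verts G \<times> verts H"
  by (simp add: disj_prod_def)

lemma adj_disj [simp]:
  "adj (disj_prod G H) (v, w) (v', w') \<longleftrightarrow>
     v \<in> verts G \<and> w \<in> verts H \<and> v' \<in> verts G \<and> w' \<in> verts H \<and> (adj G v v' \<or> adj H w w')"
  by (auto simp: disj_prod_def)

lemma verts_lex [simp]: "verts (lex_prod_graph G H) = verts G \<times> verts H"
  by (simp add: lex_prod_graph_def)

lemma adj_lex [simp]:
  "adj (lex_prod_graph G H) (v, w) (v', w') \<longleftrightarrow>
     v \<in> verts G \<and> w \<in> verts H \<and> v' \<in> verts G \<and> w' \<in> verts H \<and>
     (adj G v v' \<or> v = v' \<and> adj H w w')"
  by (auto simp: lex_prod_graph_def)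

lemma complete_graph_simps [simp]:
  "verts (complete_graph n) = {..<n}"
  "adj (complete_graph n) i j \<longleftrightarrow> i < n \<and> j < n \<and> i \<noteq> j"
  by (auto simp: complete_graph_def)

lemma induced_simps [simp]:
  "verts (induced G S) = verts G \<inter> S"
  "adj (induced G S) v w \<longleftrightarrow> v \<in> S \<and> w \<in> S \<and> adj G v w"
  by (auto simp: induced_def)

lemma verts_power [simp]: "verts (disj_power G n) = {xs. length xs = n \<and> set xs \<subseteq> verts G}"
  by (simp add: disj_power_def Let_def)

lemma adj_power:
  "adj (disj_power G n) xs ys \<longleftrightarrow>
     xs \<in> verts (disj_power G n) \<and> ys \<in> verts (disj_power G n) \<and> (\<exists>i<n. adj G (xs ! i) (ys ! i))"
  by (simp add: disj_power_def Let_def)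

lemma adj_power_Cons [simp]:
  "adj (disj_power G (Suc n)) (x # xs) (y # ys) \<longleftrightarrow>
     x \<in> verts G \<and> y \<in> verts G \<and> xs \<in> verts (disj_power G n) \<and> ys \<in> verts (disj_power G n) \<and>
     (adj G x y \<or> adj (disj_power G n) xs ys)"
  by (auto simp: adj_power Ex_less_Suc2)

section \<open>Functoriality and structural maps of joins and products\<close>

lemma join_mono:
  assumes "G \<rightarrow>\<^sub>g G'" "H \<rightarrow>\<^sub>g H'"
  shows "graph_join G H \<rightarrow>\<^sub>g graph_join G' H'"
proof -
  obtain f where f: "\<And>v. v \<in> verts G \<Longrightarrow> f v \<in> verts G'"
    "\<And>v w. v \<in> verts G \<Longrightarrow> w \<in> verts G \<Longrightarrow> adj G v w \<Longrightarrow> adj G' (f v) (f w)"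
    using assms(1) by (rule hom_toE) blast
  obtain g where g: "\<And>v. v \<in> verts H \<Longrightarrow> g v \<in> verts H'"
    "\<And>v w. v \<in> verts H \<Longrightarrow> w \<in> verts H \<Longrightarrow> adj H v w \<Longrightarrow> adj H' (g v) (g w)"
    using assms(2) by (rule hom_toE) blast
  show ?thesis
    by (rule hom_toI[of _ "map_sum f g"]) (use f g in auto)
qed

lemma disj_prod_mono:
  assumes "G \<rightarrow>\<^sub>g G'" "H \<rightarrow>\<^sub>g H'"
  shows "disj_prod G H \<rightarrow>\<^sub>g disj_prod G' H'"
proof -
  obtain f where f: "\<And>v. v \<in> verts G \<Longrightarrow> f v \<in> verts G'"
    "\<And>v w. v \<in> verts G \<Longrightarrow> w \<in> verts G \<Longrightarrow> adj G v w \<Longrightarrow> adj G' (f v) (f w)"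
    using assms(1) by (rule hom_toE) blast
  obtain g where g: "\<And>v. v \<in> verts H \<Longrightarrow> g v \<in> verts H'"
    "\<And>v w. v \<in> verts H \<Longrightarrow> w \<in> verts H \<Longrightarrow> adj H v w \<Longrightarrow> adj H' (g v) (g w)"
    using assms(2) by (rule hom_toE) blast
  show ?thesis
    by (rule hom_toI[of _ "map_prod f g"]) (use f g in auto)
qed

lemma lex_prod_mono_left:
  assumes "G \<rightarrow>\<^sub>g G'"
  shows "lex_prod_graph G H \<rightarrow>\<^sub>g lex_prod_graph G' H"
proof -
  obtain f where f: "\<And>v. v \<in> verts G \<Longrightarrow> f v \<in> verts G'"
    "\<And>v w. v \<in> verts G \<Longrightarrow> w \<in> verts G \<Longrightarrow> adj G v w \<Longrightarrow> adj G' (f v) (f w)"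
    using assms by (rule hom_toE) blast
  show ?thesis
    by (rule hom_toI[of _ "map_prod f id"]) (use f in auto)
qed

text \<open>The disjunctive product has the same vertices and more edges. Every upper bound for
  disjunctive products passes to lexicographic ones through this map.\<close>

lemma lex_hom_disj: "lex_prod_graph G H \<rightarrow>\<^sub>g disj_prod G H"
  by (rule hom_toI[of _ id]) auto

lemma lex_assoc: "lex_prod_graph G (lex_prod_graph H K) \<rightarrow>\<^sub>g lex_prod_graph (lex_prod_graph G H) K"
  by (rule hom_toI[of _ "\<lambda>(x, y, z). ((x, y), z)"]) auto

lemma join_lex:
  "graph_join (lex_prod_graph G K) (lex_prod_graph H K) \<rightarrow>\<^sub>g lex_prod_graph (graph_join G H) K"
  by (rule hom_toI[of _ "case_sum (map_prod Inl id) (map_prod Inr id)"]) auto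

lemma lex_join:
  "lex_prod_graph (graph_join G H) K \<rightarrow>\<^sub>g graph_join (lex_prod_graph G K) (lex_prod_graph H K)"
  by (rule hom_toI[of _ "\<lambda>(x, k). case x of Inl g \<Rightarrow> Inl (g, k) | Inr h \<Rightarrow> Inr (h, k)"]) auto

lemma complete_graph_Suc: "complete_graph (Suc n) \<rightarrow>\<^sub>g graph_join (complete_graph n) (complete_graph 1)"
  by (rule hom_toI[of _ "\<lambda>i. if i < n then Inl i else Inr 0"]) auto

text \<open>Division with remainder by \<open>d\<close>. It converts a map from the lexicographic
  product into \<open>F m\<close> into the inequality \<open>n * d \<le> m\<close>, which settles
  the fractional number of complete graphs.\<close>

lemma complete_graph_lex: "complete_graph (n * d) \<rightarrow>\<^sub>g lex_prod_graph (complete_graph n) (complete_graph d)"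
proof (rule hom_toI[of _ "\<lambda>i. (i div d, i mod d)"])
  fix i assume i: "i \<in> verts (complete_graph (n * d))"
  then have "d > 0" by (cases d) auto
  with i show "(i div d, i mod d) \<in> verts (lex_prod_graph (complete_graph n) (complete_graph d))"
    by (auto simp: less_mult_imp_div_less)
next
  fix i j assume ij: "i \<in> verts (complete_graph (n * d))" "j \<in> verts (complete_graph (n * d))"
    "adj (complete_graph (n * d)) i j"
  then have "d > 0" by (cases d) auto
  moreover have "i div d \<noteq> j div d \<or> i mod d \<noteq> j mod d"
    using ij(3) by (metis complete_graph_simps(2) div_mod_decomp)
  ultimately show "adj (lex_prod_graph (complete_graph n) (complete_graph d))
      (i div d, i mod d) (j div d, j mod d)"
    using ij by (auto simp: less_mult_imp_div_less)
qed

text \<open>An index below \<open>d * e\<close> is read as the pair of its quotient and remainder by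
  \<open>e\<close>. Two different indices over the same vertex differ in one of the two, which gives
  an edge in the corresponding factor. This is why fractions with denominators \<open>d\<close> and
  \<open>e\<close> multiply.\<close>

lemma disj_prod_lex_complete:
  "lex_prod_graph (disj_prod G H) (complete_graph (d * e)) \<rightarrow>\<^sub>g
     disj_prod (lex_prod_graph G (complete_graph d)) (lex_prod_graph H (complete_graph e))"
proof (rule hom_toI[of _ "\<lambda>((g, h), i). ((g, i div e), (h, i mod e))"], goal_cases)
  case (1 v)
  then show ?case
    by (cases "e = 0") (auto simp: less_mult_imp_div_less)
next
  case (2 v w)
  obtain g h i g' h' j where vw: "v = ((g, h), i)" "w = ((g', h'), j)"
    by (metis surj_pair)
  have e: "e > 0" using 2 vw by (cases e) auto
  have "i \<noteq> j \<Longrightarrow> i div e \<noteq> j div e \<or> i mod e \<noteq> j mod e"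
    by (metis div_mod_decomp)
  with 2 e show ?case unfolding vw
    by (auto simp: less_mult_imp_div_less)
qed

section \<open>Disjunctive powers\<close>

lemma disj_power_0: "disj_power G 0 \<rightarrow>\<^sub>g complete_graph 1" "complete_graph 1 \<rightarrow>\<^sub>g disj_power G 0"
  by (rule hom_toI[of _ "\<lambda>_. 0"]; simp add: adj_power)
     (rule hom_toI[of _ "\<lambda>_. []"]; simp)

lemma disj_power_1: "disj_power G 1 \<rightarrow>\<^sub>g G"
  by (rule hom_toI[of _ hd]) (auto simp: adj_power length_Suc_conv)

lemma disj_power_Suc_inv: "disj_prod G (disj_power G n) \<rightarrow>\<^sub>g disj_power G (Suc n)"
  by (rule hom_toI[of _ "\<lambda>(x, xs). x # xs"]) auto

lemma disj_power_mono:
  assumes "G \<rightarrow>\<^sub>g H"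
  shows "disj_power G n \<rightarrow>\<^sub>g disj_power H n"
proof -
  obtain f where f: "\<And>v. v \<in> verts G \<Longrightarrow> f v \<in> verts H"
    "\<And>v w. v \<in> verts G \<Longrightarrow> w \<in> verts G \<Longrightarrow> adj G v w \<Longrightarrow> adj H (f v) (f w)"
    using assms by (rule hom_toE) blast
  show ?thesis
  proof (rule hom_toI[of _ "map f"], goal_cases)
    case (1 v)
    then show ?case using f(1) by auto
  next
    case (2 v w)
    then obtain i where i: "i < n" "adj G (v ! i) (w ! i)" by (auto simp: adj_power)
    then have "adj H (map f v ! i) (map f w ! i)"
      using 2(1,2) f(2)[of "v ! i" "w ! i"] by (auto simp: subset_iff)
    then show ?case using 2(1,2) i f(1) by (auto simp: adj_power simp del: nth_map)
  qed
qed

lemma disj_power_add: "disj_power G (m + n) \<rightarrow>\<^sub>g disj_prod (disj_power G m) (disj_power G n)"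
proof (rule hom_toI[of _ "\<lambda>xs. (take m xs, drop m xs)"], goal_cases)
  case (1 v)
  then show ?case by (auto dest: in_set_takeD in_set_dropD)
next
  case (2 v w)
  then obtain i where i: "i < m + n" "adj G (v ! i) (w ! i)" by (auto simp: adj_power)
  have "(\<exists>i<m. adj G (take m v ! i) (take m w ! i)) \<or> (\<exists>i<n. adj G (drop m v ! i) (drop m w ! i))"
  proof (cases "i < m")
    case True
    then show ?thesis using i by auto
  next
    case False
    then have "i - m < n" "m + (i - m) = i" using i(1) by auto
    then show ?thesis using i(2) 2(1,2) by (metis (mono_tags, lifting) le_add1 mem_Collect_eq nth_drop verts_power)
  qed
  with 2(1,2) show ?case by (auto simp: adj_power dest: in_set_takeD in_set_dropD)
qed

lemma disj_power_disj_prod: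
  "disj_power (disj_prod G H) n \<rightarrow>\<^sub>g disj_prod (disj_power G n) (disj_power H n)"
proof (rule hom_toI[of _ "\<lambda>xs. (map fst xs, map snd xs)"], goal_cases)
  case (1 v)
  then show ?case by auto
next
  case (2 v w)
  then obtain i where i: "i < n" "adj (disj_prod G H) (v ! i) (w ! i)" by (auto simp: adj_power)
  then have "adj G (fst (v ! i)) (fst (w ! i)) \<or> adj H (snd (v ! i)) (snd (w ! i))"
    by (metis adj_disj prod.collapse)
  with 2(1,2) i(1) show ?case
    by (auto simp: adj_power)
qed

text \<open>One step of the binomial expansion: the first entry of the last list belongs to
  \<open>G\<close> or to \<open>H\<close> and is moved to the matching accumulator. Entries of
  different kinds land in different summands, where the join supplies the edge. For equal kinds, an
  edge at the moved position becomes an edge of the accumulators.\<close>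

lemma disj_power_join_Suc:
  "disj_prod (disj_prod (disj_power G i) (disj_power H j)) (disj_power (graph_join G H) (Suc n)) \<rightarrow>\<^sub>g
   graph_join (disj_prod (disj_prod (disj_power G (Suc i)) (disj_power H j)) (disj_power (graph_join G H) n))
     (disj_prod (disj_prod (disj_power G i) (disj_power H (Suc j))) (disj_power (graph_join G H) n))"
proof (rule hom_toI[of _ "\<lambda>((xs, ys), zs). case hd zs of Inl g \<Rightarrow> Inl ((g # xs, ys), tl zs)
    | Inr h \<Rightarrow> Inr ((xs, h # ys), tl zs)"], goal_cases)
  case (1 v)
  then show ?case by (auto simp: length_Suc_conv) blast+
next
  case (2 v w)
  obtain xs ys zs xs' ys' zs' where vw: "v = ((xs, ys), zs)" "w = ((xs', ys'), zs')"
    by (metis surj_pair)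
  from 2 vw obtain z zt z' zt' where z: "zs = z # zt" "zs' = z' # zt'"
    by (auto simp: length_Suc_conv)
  show ?case using 2 unfolding vw z by (cases z; cases z') auto
qed

section \<open>Cliques and fractionalization\<close>

lemma simple_graphD:
  assumes "simple_graph G" "adj G v w"
  shows "v \<in> verts G" "w \<in> verts G" "v \<noteq> w" "adj G w v"
  using assms unfolding simple_graph_def by auto

section \<open>Finite graphs are closed under the constructions\<close>

lemma finite_graph_complete: "finite_graph (complete_graph n)"
  by (auto simp: finite_graph_def simple_graph_def)

lemma finite_graph_join:
  assumes "finite_graph G" "finite_graph H"
  shows "finite_graph (graph_join G H)"
proof -
  note G = simple_graphD[of G] and H = simple_graphD[of H]
  have "x \<in> verts (graph_join G H) \<and> y \<in> verts (graph_join G H) \<and> x \<noteq> y \<and> adj (graph_join G H) y x"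
    if "adj (graph_join G H) x y" for x y
    using that assms G[of "projl x" "projl y"] H[of "projr x" "projr y"]
    by (cases x; cases y) (auto simp: finite_graph_def)
  then show ?thesis using assms unfolding finite_graph_def simple_graph_def by simp
qed

lemma finite_graph_disj:
  assumes "finite_graph G" "finite_graph H"
  shows "finite_graph (disj_prod G H)"
proof -
  have "x \<in> verts (disj_prod G H) \<and> y \<in> verts (disj_prod G H) \<and> x \<noteq> y \<and> adj (disj_prod G H) y x"
    if "adj (disj_prod G H) x y" for x y
    using that assms simple_graphD(3,4)[of G "fst x" "fst y"] simple_graphD(3,4)[of H "snd x" "snd y"]
    by (cases x; cases y) (auto simp: finite_graph_def)
  then show ?thesis using assms unfolding finite_graph_def simple_graph_def by simp
qed

lemma finite_graph_lex:
  assumes "finite_graph G" "finite_graph H"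
  shows "finite_graph (lex_prod_graph G H)"
proof -
  have "x \<in> verts (lex_prod_graph G H) \<and> y \<in> verts (lex_prod_graph G H) \<and> x \<noteq> y \<and>
      adj (lex_prod_graph G H) y x"
    if "adj (lex_prod_graph G H) x y" for x y
    using that assms simple_graphD(3,4)[of G "fst x" "fst y"] simple_graphD(3,4)[of H "snd x" "snd y"]
    by (cases x; cases y) (auto simp: finite_graph_def)
  then show ?thesis using assms unfolding finite_graph_def simple_graph_def by simp
qed

lemma finite_graph_power:
  assumes "finite_graph G"
  shows "finite_graph (disj_power G n)"
proof -
  have "finite {xs. set xs \<subseteq> verts G \<and> length xs = n}"
    using assms by (intro finite_lists_length_eq) (simp add: finite_graph_def)
  then have "finite (verts (disj_power G n))" by (simp add: conj_commute)
  moreover have "simple_graph (disj_power G n)"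
    unfolding simple_graph_def
  proof (intro allI impI)
    fix xs ys assume adj: "adj (disj_power G n) xs ys"
    then obtain i where i: "i < n" "adj G (xs ! i) (ys ! i)" by (auto simp: adj_power)
    then have "xs ! i \<noteq> ys ! i" "adj G (ys ! i) (xs ! i)"
      using assms simple_graphD(3,4) by (metis finite_graph_def)+
    then show "xs \<in> verts (disj_power G n) \<and> ys \<in> verts (disj_power G n) \<and> xs \<noteq> ys \<and>
        adj (disj_power G n) ys xs"
      using adj i(1) by (auto simp: adj_power)
  qed
  ultimately show ?thesis by (simp add: finite_graph_def)
qed

lemma finite_graph_hom_complete:
  assumes "finite_graph G"
  shows "G \<rightarrow>\<^sub>g complete_graph (card (verts G))"
proof -
  obtain b where b: "bij_betw b (verts G) {0..<card (verts G)}"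
    using assms ex_bij_betw_finite_nat unfolding finite_graph_def by blast
  show ?thesis
  proof (rule hom_toI[of _ b], goal_cases)
    case (1 v)
    then show ?case using b by (auto simp: bij_betw_def)
  next
    case (2 v w)
    then have "v \<noteq> w" using assms simple_graphD(3) unfolding finite_graph_def by metis
    with 2 show ?case using b by (auto simp: bij_betw_def inj_on_def)
  qed
qed

section \<open>Cliques as images of complete graphs\<close>

lemma is_clique_imp_hom:
  assumes "is_clique G d S"
  shows "complete_graph d \<rightarrow>\<^sub>g induced G S"
proof -
  obtain b where b: "bij_betw b {0..<d} S"
    using assms ex_bij_betw_nat_finite[of S] unfolding is_clique_def by auto
  have bS: "b i \<in> S" if "i < d" for i
    using b that by (auto simp: bij_betw_def)
  have bneq: "b i \<noteq> b j" if "i < d" "j < d" "i \<noteq> j" for i j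
    using b that by (auto simp: bij_betw_def inj_on_def)
  show ?thesis
    by (rule hom_toI[of _ b]) (use bS bneq assms in \<open>auto simp: is_clique_def\<close>)
qed

lemma hom_imp_is_clique:
  assumes "simple_graph G" "complete_graph d \<rightarrow>\<^sub>g induced G S"
  shows "\<exists>C \<subseteq> S. is_clique G d C"
proof -
  obtain f where f': "\<And>v. v \<in> verts (complete_graph d) \<Longrightarrow> f v \<in> verts (induced G S)"
    "\<And>v w. v \<in> verts (complete_graph d) \<Longrightarrow> w \<in> verts (complete_graph d) \<Longrightarrow>
       adj (complete_graph d) v w \<Longrightarrow> adj (induced G S) (f v) (f w)"
    using assms(2) by (rule hom_toE) blast
  have f: "f v \<in> verts G" "f v \<in> S" if "v < d" for v
    using f'(1) that by auto
  have adj: "adj G (f v) (f w)" if "v < d" "w < d" "v \<noteq> w" for v w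
    using f'(2)[of v w] that by simp
  \<comment> \<open>Adjacent vertices of a simple graph are distinct, so a homomorphism out of a
    complete graph cannot identify vertices.\<close>
  have "inj_on f {..<d}"
    using adj simple_graphD(3)[OF assms(1)] unfolding inj_on_def by (metis lessThan_iff)
  then have "is_clique G d (f ` {..<d})"
    unfolding is_clique_def using f(1) adj by (auto simp: card_image)
  moreover have "f ` {..<d} \<subseteq> S" using f(2) by auto
  ultimately show ?thesis by blast
qed

lemma is_clique_mono: "is_clique G d S \<Longrightarrow> T \<subseteq> S \<Longrightarrow> is_clique G (card T) T"
  unfolding is_clique_def by (auto intro: finite_subset)

lemma is_clique_Un:
  assumes "simple_graph G" "is_clique G d S" "is_clique G e T" "\<And>s t. s \<in> S \<Longrightarrow> t \<in> T \<Longrightarrow> adj G s t"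
  shows "is_clique G (d + e) (S \<union> T)"
proof -
  have "S \<inter> T = {}" using assms(4) simple_graphD(3)[OF assms(1)] by blast
  then have "card (S \<union> T) = d + e"
    using assms(2,3) unfolding is_clique_def by (simp add: card_Un_disjoint)
  moreover have "adj G t s" if "s \<in> S" "t \<in> T" for s t
    using assms(4)[OF that] by (rule simple_graphD(4)[OF assms(1)])
  ultimately show ?thesis
    using assms(2-4) unfolding is_clique_def by auto
qed

lemma is_clique_induced: "is_clique (induced G S) d C \<longleftrightarrow> is_clique G d C \<and> C \<subseteq> S"
  unfolding is_clique_def by auto

lemma clique_number_eqD:
  assumes "clique_number G = enat k"
  shows "\<exists>S. is_clique G k S" "is_clique G d S \<Longrightarrow> d \<le> k"
proof -
  let ?A = "{enat d | d. \<exists>S. is_clique G d S}"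
  have ne: "enat 0 \<in> ?A" by (auto simp: is_clique_def intro!: exI[of _ "{}"])
  have sup: "Sup ?A = enat k" using assms by (simp add: clique_number_def)
  \<comment> \<open>An infinite set of extended naturals has supremum infinity. A finite supremum is
    thus a maximum, attained because the empty clique keeps the set nonempty.\<close>
  have "finite ?A"
    using sup ne by (auto simp: Sup_enat_def split: if_splits)
  then have "enat k \<in> ?A"
    using sup ne Max_in[of ?A] by (auto simp: Sup_enat_def split: if_splits)
  then show "\<exists>S. is_clique G k S" by auto
  show "d \<le> k" if "is_clique G d S"
  proof -
    have "enat d \<le> Sup ?A" using that by (intro Sup_upper) auto
    then show ?thesis using sup by simp
  qed
qed

text \<open>Enumerating the clique assigned to each vertex uncurries the map. Conversely, a fibre
  over a vertex has an image of exactly \<open>d\<close> elements because \<open>K\<close> has no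
  loops. From here on fractions are handled by composing homomorphisms instead of choosing
  cliques.\<close>

lemma hom_fractionalization_iff:
  assumes "simple_graph K"
  shows "G \<rightarrow>\<^sub>g fractionalization K d \<longleftrightarrow> lex_prod_graph G (complete_graph d) \<rightarrow>\<^sub>g K"
proof
  assume "G \<rightarrow>\<^sub>g fractionalization K d"
  then obtain f where f': "\<And>v. v \<in> verts G \<Longrightarrow> f v \<in> verts (fractionalization K d)"
    "\<And>v w. v \<in> verts G \<Longrightarrow> w \<in> verts G \<Longrightarrow> adj G v w \<Longrightarrow> adj (fractionalization K d) (f v) (f w)"
    by (rule hom_toE) blast
  have f: "\<And>v. v \<in> verts G \<Longrightarrow> is_clique K d (f v)"
    "\<And>v w. v \<in> verts G \<Longrightarrow> w \<in> verts G \<Longrightarrow> adj G v w \<Longrightarrow> \<forall>s\<in>f v. \<forall>t\<in>f w. adj K s t"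
    using f' by (simp_all add: fractionalization_def)
  have "\<forall>v\<in>verts G. \<exists>b. bij_betw b {0..<d} (f v)"
    using f(1) ex_bij_betw_nat_finite unfolding is_clique_def by metis
  then obtain b where b: "\<And>v. v \<in> verts G \<Longrightarrow> bij_betw (b v) {0..<d} (f v)" by metis
  have bin: "b v i \<in> f v" if "v \<in> verts G" "i < d" for v i
    using b[OF that(1)] that(2) by (auto simp: bij_betw_def)
  have bneq: "b v i \<noteq> b v j" if "v \<in> verts G" "i < d" "j < d" "i \<noteq> j" for v i j
    using b[OF that(1)] that by (auto simp: bij_betw_def inj_on_def)
  have inK: "b v i \<in> verts K" if "v \<in> verts G" "i < d" for v i
    using bin[OF that] f(1)[OF that(1)] unfolding is_clique_def by blast
  have same: "adj K (b v i) (b v j)" if "v \<in> verts G" "i < d" "j < d" "i \<noteq> j" for v i j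
    using bin that bneq[OF that] f(1)[OF that(1)] unfolding is_clique_def by blast
  have diff: "adj K (b v i) (b w j)"
    if "v \<in> verts G" "w \<in> verts G" "adj G v w" "i < d" "j < d" for v w i j
    using bin f(2) that by blast
  show "lex_prod_graph G (complete_graph d) \<rightarrow>\<^sub>g K"
    by (rule hom_toI[of _ "\<lambda>(v, i). b v i"]) (use inK same diff in auto)
next
  assume "lex_prod_graph G (complete_graph d) \<rightarrow>\<^sub>g K"
  then obtain f where f: "\<And>v. v \<in> verts G \<times> {..<d} \<Longrightarrow> f v \<in> verts K"
    "\<And>v w. v \<in> verts G \<times> {..<d} \<Longrightarrow> w \<in> verts G \<times> {..<d} \<Longrightarrow>
       adj (lex_prod_graph G (complete_graph d)) v w \<Longrightarrow> adj K (f v) (f w)"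
    by (elim hom_toE) auto
  have clique: "is_clique K d ((\<lambda>i. f (v, i)) ` {..<d})" if "v \<in> verts G" for v
  proof -
    have a: "adj K (f (v, i)) (f (v, j))" if "i < d" "j < d" "i \<noteq> j" for i j
      using f(2)[of "(v, i)" "(v, j)"] that \<open>v \<in> verts G\<close> by auto
    then have "inj_on (\<lambda>i. f (v, i)) {..<d}"
      using simple_graphD(3)[OF assms] unfolding inj_on_def by (metis lessThan_iff)
    then show ?thesis
      unfolding is_clique_def using f(1) a that by (auto simp: card_image)
  qed
  have a: "adj K (f (v, i)) (f (w, j))"
    if "v \<in> verts G" "w \<in> verts G" "adj G v w" "i < d" "j < d" for v w i j
    using f(2)[of "(v, i)" "(w, j)"] that by auto
  show "G \<rightarrow>\<^sub>g fractionalization K d"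
  proof (rule hom_toI[of _ "\<lambda>v. (\<lambda>i. f (v, i)) ` {..<d}"], goal_cases)
    case (1 v)
    then show ?case using clique by (simp add: fractionalization_def)
  next
    case (2 v w)
    then have "\<forall>s\<in>(\<lambda>i. f (v, i)) ` {..<d}. \<forall>t\<in>(\<lambda>i. f (w, i)) ` {..<d}. adj K s t"
      using a by auto
    moreover from this
    have "(\<lambda>i. f (v, i)) ` {..<d} \<inter> (\<lambda>i. f (w, i)) ` {..<d} = {}"
      using simple_graphD(3)[OF assms] by blast
    ultimately show ?case using clique 2 by (simp add: fractionalization_def)
  qed
qed

section \<open>Flats\<close>

lemma perp_antimono: "S \<subseteq> T \<Longrightarrow> perp G T \<subseteq> perp G S"
  unfolding perp_def by blast

lemma perp_subset_verts: "perp G S \<subseteq> verts G"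
  unfolding perp_def by blast

lemma subset_perp_perp: "simple_graph G \<Longrightarrow> S \<subseteq> verts G \<Longrightarrow> S \<subseteq> perp G (perp G S)"
  unfolding perp_def by (auto dest: simple_graphD(4))

text \<open>Symmetry of adjacency makes \<open>perp\<close> an antitone Galois connection with
  itself. One inclusion is \<open>perp\<close> applied to
  \<open>S \<subseteq> perp G (perp G S)\<close>, the other is that inclusion for
  \<open>perp G S\<close>. Hence every perp is a flat, which is the source of all flats used
  below.\<close>

lemma perp_perp_perp: "simple_graph G \<Longrightarrow> S \<subseteq> verts G \<Longrightarrow> perp G (perp G (perp G S)) = perp G S"
  by (intro equalityI perp_antimono subset_perp_perp perp_subset_verts)

lemma is_flat_perp: "simple_graph G \<Longrightarrow> S \<subseteq> verts G \<Longrightarrow> is_flat G (perp G S)"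
  by (simp add: is_flat_def perp_perp_perp perp_subset_verts)

lemma adj_perp: "v \<in> perp G S \<Longrightarrow> s \<in> S \<Longrightarrow> adj G v s"
  unfolding perp_def by blast

lemma hom_induced_image:
  assumes "graph_hom G H f" "f ` verts G \<subseteq> S"
  shows "G \<rightarrow>\<^sub>g induced H S"
  by (rule hom_toI[of _ f]) (use assms in \<open>auto simp: graph_hom_def\<close>)

section \<open>Infima and submultiplicative sequences\<close>

lemma le_Inf_add_Inf:
  fixes A B :: "real set"
  assumes "A \<noteq> {}" "B \<noteq> {}" "\<And>x y. x \<in> A \<Longrightarrow> y \<in> B \<Longrightarrow> c \<le> x + y"
  shows "c \<le> Inf A + Inf B"
proof -
  have "c - x \<le> Inf B" if "x \<in> A" for x
    using assms(2) assms(3)[OF that] by (intro cInf_greatest) (auto simp: algebra_simps)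
  then have "c - Inf B \<le> Inf A"
    using assms(1) by (intro cInf_greatest) (auto simp: algebra_simps)
  then show ?thesis by simp
qed

text \<open>Dividing by one factor at a time leaves an infimum over a single set. A zero factor
  cannot be divided by, but then the hypothesis already gives \<open>c \<le> 0\<close>.\<close>

lemma le_Inf_mult_Inf:
  fixes A B :: "real set"
  assumes "A \<noteq> {}" "B \<noteq> {}" "\<And>x. x \<in> A \<Longrightarrow> 0 \<le> x" "\<And>y. y \<in> B \<Longrightarrow> 0 \<le> y"
    and "\<And>x y. x \<in> A \<Longrightarrow> y \<in> B \<Longrightarrow> c \<le> x * y"
  shows "c \<le> Inf A * Inf B"
proof -
  have *: "c \<le> x * Inf B" if x: "x \<in> A" for x
  proof (cases "x = 0")
    case True
    then show ?thesis using assms(2,5) x by force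
  next
    case False
    then have pos: "x > 0" using assms(3)[OF x] by simp
    have "c / x \<le> Inf B"
      using assms(2) assms(5)[OF x] pos by (intro cInf_greatest) (auto simp: field_simps)
    then show ?thesis using pos by (simp add: field_simps)
  qed
  have nonneg: "Inf B \<ge> 0" using assms(2,4) by (intro cInf_greatest)
  show ?thesis
  proof (cases "Inf B = 0")
    case True
    then show ?thesis using * assms(1) by force
  next
    case False
    then have pos: "Inf B > 0" using nonneg by simp
    have "c / Inf B \<le> Inf A"
      using assms(1) * pos by (intro cInf_greatest) (auto simp: field_simps)
    then show ?thesis using pos by (simp add: field_simps)
  qed
qed

text \<open>The estimate behind Fekete's lemma: removing blocks of length \<open>p\<close> costs a
  factor \<open>x ^ p\<close> each, and only a remainder below \<open>p\<close> is left for the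
  constant.\<close>

lemma submultiplicative_growth:
  fixes a :: "nat \<Rightarrow> real"
  assumes nonneg: "\<And>n. 0 \<le> a n" and submult: "\<And>m n. a (m + n) \<le> a m * a n"
    and "p \<ge> 1" "x > 0" "a p \<le> x ^ p"
  shows "\<exists>C>0. \<forall>k. a k \<le> C * x ^ k"
proof -
  \<comment> \<open>The sum dominates \<open>a r / x ^ r\<close> for every remainder
    \<open>r < p\<close>; the added 1 keeps \<open>C\<close> positive if all these terms
    vanish.\<close>
  define C where "C = 1 + (\<Sum>r<p. a r / x ^ r)"
  have Cpos: "C > 0"
    unfolding C_def using nonneg \<open>x > 0\<close> by (intro add_pos_nonneg sum_nonneg) auto
  have "a k \<le> C * x ^ k" for k
  proof (induction k rule: less_induct)
    case (less k)
    show ?case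
    proof (cases "k < p")
      case True
      have "a k / x ^ k \<le> (\<Sum>r<p. a r / x ^ r)"
        using nonneg \<open>x > 0\<close> True by (intro member_le_sum) auto
      then have "a k / x ^ k \<le> C" unfolding C_def by simp
      then show ?thesis using \<open>x > 0\<close> by (simp add: field_simps)
    next
      case False
      then have k: "p + (k - p) = k" "k - p < k" using \<open>p \<ge> 1\<close> by auto
      have "a k \<le> a p * a (k - p)" using submult[of p "k - p"] k by simp
      also have "\<dots> \<le> x ^ p * (C * x ^ (k - p))"
        using less[OF k(2)] nonneg \<open>x > 0\<close> assms(5) by (intro mult_mono) auto
      also have "\<dots> = C * x ^ k" using k(1) by (metis mult.left_commute power_add)
      finally show ?thesis .
    qed
  qed
  with Cpos show ?thesis by blast
qed

section \<open>Linear-like semiring families\<close>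

locale linear_like_family =
  fixes F :: "nat \<Rightarrow> 'f ugraph"
  assumes semiring: "semiring_family F" and linear: "linear_like F"
begin

section \<open>Consequences of the semiring axioms\<close>

lemma simple_F: "simple_graph (F n)"
  using semiring unfolding semiring_family_def by blast

lemma join_hom_F: "G \<rightarrow>\<^sub>g F n \<Longrightarrow> H \<rightarrow>\<^sub>g F m \<Longrightarrow> graph_join G H \<rightarrow>\<^sub>g F (n + m)"
  using semiring join_mono hom_to_trans unfolding semiring_family_def by metis

lemma disj_hom_F: "G \<rightarrow>\<^sub>g F n \<Longrightarrow> H \<rightarrow>\<^sub>g F m \<Longrightarrow> disj_prod G H \<rightarrow>\<^sub>g F (n * m)"
  using semiring disj_prod_mono hom_to_trans unfolding semiring_family_def by metis

text \<open>The axioms do not state that the family is increasing; the join with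
  \<open>F (m - n)\<close> provides the map from \<open>F n\<close> to \<open>F m\<close>.\<close>

lemma hom_F_mono:
  assumes "G \<rightarrow>\<^sub>g F n" "n \<le> m"
  shows "G \<rightarrow>\<^sub>g F m"
proof -
  have "graph_join (F n) (F (m - n)) \<rightarrow>\<^sub>g F m"
    using semiring assms(2) unfolding semiring_family_def by (metis le_add_diff_inverse)
  moreover have "F n \<rightarrow>\<^sub>g graph_join (F n) (F (m - n))"
    by (rule hom_toI[of _ Inl]) auto
  ultimately show ?thesis using assms(1) by (meson hom_to_trans)
qed

lemma complete_hom_F: "complete_graph n \<rightarrow>\<^sub>g F n"
proof (induction n)
  case 0
  show ?case by (rule hom_toI) auto
next
  case (Suc n)
  obtain v where "v \<in> verts (F 1)" using semiring unfolding semiring_family_def by blast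
  then have "complete_graph 1 \<rightarrow>\<^sub>g F 1" by (intro hom_toI[of _ "\<lambda>_. v"]) auto
  then have "graph_join (complete_graph n) (complete_graph 1) \<rightarrow>\<^sub>g F (n + 1)"
    using Suc by (rule join_hom_F[rotated])
  then show ?case using hom_to_trans[OF complete_graph_Suc] by simp
qed

lemma finite_hom_F:
  assumes "finite_graph G"
  shows "\<exists>n. G \<rightarrow>\<^sub>g F n"
  using hom_to_trans[OF finite_graph_hom_complete[OF assms] complete_hom_F] by blast

text \<open>A flat is its own double perp, so its rank is the clique number of the subgraph it
  induces. The same \<open>k\<close> is therefore both the index of the equivalent member of the
  family and the size of a largest clique \<open>C\<close> in the flat.\<close>

lemma flatE:
  assumes "is_flat (F n) S"
  obtains k C where "induced (F n) S \<rightarrow>\<^sub>g F k" "F k \<rightarrow>\<^sub>g induced (F n) S"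
    "C \<subseteq> S" "is_clique (F n) k C" "\<And>d D. is_clique (F n) d D \<Longrightarrow> D \<subseteq> S \<Longrightarrow> d \<le> k"
proof -
  obtain k where k: "flat_rank (F n) S = enat k" "hom_equiv (induced (F n) S) (F k)"
    using linear assms unfolding linear_like_def by blast
  have "clique_number (induced (F n) S) = enat k"
    using k(1) assms unfolding flat_rank_def is_flat_def by simp
  from clique_number_eqD[OF this] k(2) that show ?thesis
    unfolding hom_equiv_def is_clique_induced by blast
qed

text \<open>Extend an \<open>n\<close>-clique of a maximum clique by the rest: its double perp is a flat of rank
  exactly \<open>n\<close>, so \<open>F n\<close> maps into a graph without larger cliques.\<close>

lemma clique_F_le:
  assumes "is_clique (F n) d D"
  shows "d \<le> n"
proof -
  \<comment> \<open>The whole vertex set is a flat, so linear-likeness makes the clique number of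
    \<open>F n\<close> a finite \<open>k\<close>.\<close>
  have "perp (F n) {} = verts (F n)" by (simp add: perp_def)
  then have "is_flat (F n) (verts (F n))" using is_flat_perp[OF simple_F, of "{}" n] by simp
  then obtain k C where kC: "is_clique (F n) k C"
    "\<And>d D. is_clique (F n) d D \<Longrightarrow> D \<subseteq> verts (F n) \<Longrightarrow> d \<le> k"
    by (rule flatE) blast
  have max: "e \<le> k" if "is_clique (F n) e E" for e E
    using kC(2)[OF that] that unfolding is_clique_def by blast
  have "F n \<rightarrow>\<^sub>g induced (F n) (verts (F n))"
    by (rule hom_toI[of _ id]) auto
  then have "\<exists>E \<subseteq> verts (F n). is_clique (F n) n E"
    using complete_hom_F by (intro hom_imp_is_clique[OF simple_F]) (rule hom_to_trans)
  then have "n \<le> k" using max by blast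
  moreover have C: "finite C" "card C = k" "C \<subseteq> verts (F n)" using kC(1) unfolding is_clique_def by auto
  \<comment> \<open>The size is chosen as \<open>n\<close> so that the flat spanned by
    \<open>B\<close>, once its rank is known, is compared with \<open>F n\<close> itself.\<close>
  ultimately obtain B where B: "B \<subseteq> C" "card B = n" by (metis obtain_subset_with_card_n)
  have Bv: "B \<subseteq> verts (F n)" using B C by blast
  define S where "S = perp (F n) (perp (F n) B)"
  have "is_flat (F n) S"
    unfolding S_def by (rule is_flat_perp[OF simple_F perp_subset_verts])
  then obtain r R where r: "F r \<rightarrow>\<^sub>g induced (F n) S" "R \<subseteq> S" "is_clique (F n) r R"
    "\<And>d D. is_clique (F n) d D \<Longrightarrow> D \<subseteq> S \<Longrightarrow> d \<le> r"
    by (rule flatE) blast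
  have "B \<subseteq> S" unfolding S_def using Bv by (rule subset_perp_perp[OF simple_F])
  then have "n \<le> r" using r(4)[OF is_clique_mono[OF kC(1) B(1)]] B(2) by simp
  have "adj (F n) c b" if "c \<in> C - B" "b \<in> B" for b c
  proof -
    have "c \<noteq> b" "c \<in> C" "b \<in> C" using that B(1) by auto
    then show ?thesis using kC(1) unfolding is_clique_def by simp
  qed
  then have "C - B \<subseteq> perp (F n) B" using C(3) unfolding perp_def by auto
  then have "adj (F n) s t" if "s \<in> R" "t \<in> C - B" for s t
    using that r(2) unfolding S_def by (intro adj_perp[of s _ "perp (F n) B"]) auto
  \<comment> \<open>Exchanging \<open>B\<close> for \<open>R\<close> inside the maximum clique
    \<open>C\<close> yields a clique again, so \<open>R\<close> cannot be larger than
    \<open>B\<close>.\<close>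
  then have "is_clique (F n) (r + card (C - B)) (R \<union> (C - B))"
    by (intro is_clique_Un simple_F r(3) is_clique_mono[OF kC(1)]) auto
  then have "r + card (C - B) \<le> k" by (rule max)
  moreover have "card (C - B) = k - n"
    using B C by (simp add: card_Diff_subset finite_subset[OF B(1)])
  ultimately have "r = n" using \<open>n \<le> r\<close> \<open>n \<le> k\<close> by simp
  \<comment> \<open>With \<open>r = n\<close>, the graph \<open>F n\<close> maps into the subgraph
    induced on \<open>S\<close>. This carries the \<open>k\<close>-clique into \<open>S\<close>,
    whose cliques have at most \<open>n\<close> vertices.\<close>
  have "complete_graph k \<rightarrow>\<^sub>g induced (F n) C" using kC(1) by (rule is_clique_imp_hom)
  moreover have "induced (F n) C \<rightarrow>\<^sub>g F n" by (rule hom_toI[of _ id]) auto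
  ultimately have "complete_graph k \<rightarrow>\<^sub>g induced (F n) S"
    using r(1) \<open>r = n\<close> by (metis hom_to_trans)
  then have "k \<le> r" using hom_imp_is_clique[OF simple_F] r(4) by blast
  then show ?thesis using max[OF assms] \<open>r = n\<close> by simp
qed

lemma complete_hom_F_iff: "complete_graph m \<rightarrow>\<^sub>g F n \<longleftrightarrow> m \<le> n"
proof
  assume h: "complete_graph m \<rightarrow>\<^sub>g F n"
  have "F n \<rightarrow>\<^sub>g induced (F n) (verts (F n))"
    by (rule hom_toI[of _ id]) auto
  with h have "complete_graph m \<rightarrow>\<^sub>g induced (F n) (verts (F n))" by (rule hom_to_trans)
  then show "m \<le> n" using hom_imp_is_clique[OF simple_F] clique_F_le by blast
qed (use complete_hom_F hom_F_mono in blast)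

text \<open>Superadditivity is stated for homomorphisms rather than for \<open>F_number\<close>,
  since the fractional number needs it for the lexicographic products of \<open>G\<close> and
  \<open>H\<close> with a common complete graph.\<close>

lemma join_hom_F_split:
  assumes "graph_join G H \<rightarrow>\<^sub>g F n"
  shows "\<exists>r s. r + s \<le> n \<and> G \<rightarrow>\<^sub>g F r \<and> H \<rightarrow>\<^sub>g F s"
proof -
  obtain f where f: "graph_hom (graph_join G H) (F n) f" using assms unfolding hom_to_def by blast
  define A where "A = (\<lambda>v. f (Inl v)) ` verts G"
  have A: "A \<subseteq> verts (F n)" using f unfolding A_def graph_hom_def by auto
  let ?S = "perp (F n) (perp (F n) A)" and ?T = "perp (F n) A"
  have "graph_hom G (F n) (\<lambda>v. f (Inl v))" "graph_hom H (F n) (\<lambda>v. f (Inr v))"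
    using f unfolding graph_hom_def Pi_iff
    by (simp_all add: InlI InrI)
  moreover have "(\<lambda>v. f (Inl v)) ` verts G \<subseteq> ?S"
    using subset_perp_perp[OF simple_F A] unfolding A_def .
  moreover have "adj (F n) (f (Inr w)) (f (Inl v))" if "v \<in> verts G" "w \<in> verts H" for v w
    using f that unfolding graph_hom_def by (simp add: InlI InrI)
  then have "(\<lambda>v. f (Inr v)) ` verts H \<subseteq> ?T"
    using f unfolding A_def perp_def graph_hom_def by auto
  ultimately have GH: "G \<rightarrow>\<^sub>g induced (F n) ?S" "H \<rightarrow>\<^sub>g induced (F n) ?T"
    by (blast intro: hom_induced_image)+
  have "is_flat (F n) ?S" by (intro is_flat_perp simple_F perp_subset_verts)
  then obtain r R where r: "induced (F n) ?S \<rightarrow>\<^sub>g F r" "R \<subseteq> ?S" "is_clique (F n) r R"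
    by (rule flatE) blast
  have "is_flat (F n) ?T" using A by (intro is_flat_perp simple_F)
  then obtain t T where t: "induced (F n) ?T \<rightarrow>\<^sub>g F t" "T \<subseteq> ?T" "is_clique (F n) t T"
    by (rule flatE) blast
  \<comment> \<open>\<open>?S\<close> is the perp of \<open>?T\<close>, so the two cliques are
    completely joined.\<close>
  have "is_clique (F n) (r + t) (R \<union> T)"
    using r(2) t(2) by (intro is_clique_Un simple_F r t) (blast intro: adj_perp)
  then have "r + t \<le> n" by (rule clique_F_le)
  then show ?thesis using hom_to_trans[OF GH(1) r(1)] hom_to_trans[OF GH(2) t(1)] by blast
qed

section \<open>The integral number\<close>

lemma F_number_le: "G \<rightarrow>\<^sub>g F n \<Longrightarrow> F_number F G \<le> n"
  unfolding F_number_def by (rule Least_le)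

lemma hom_F_number: "finite_graph G \<Longrightarrow> G \<rightarrow>\<^sub>g F (F_number F G)"
  using finite_hom_F unfolding F_number_def by (metis LeastI_ex)

lemma F_number_mono: "finite_graph H \<Longrightarrow> G \<rightarrow>\<^sub>g H \<Longrightarrow> F_number F G \<le> F_number F H"
  by (intro F_number_le) (rule hom_to_trans[OF _ hom_F_number])

lemma F_number_join:
  assumes "finite_graph G" "finite_graph H"
  shows "F_number F (graph_join G H) = F_number F G + F_number F H"
proof (rule antisym)
  show "F_number F (graph_join G H) \<le> F_number F G + F_number F H"
    using assms by (intro F_number_le join_hom_F hom_F_number)
  obtain r s where "r + s \<le> F_number F (graph_join G H)" "G \<rightarrow>\<^sub>g F r" "H \<rightarrow>\<^sub>g F s"
    using join_hom_F_split[OF hom_F_number[OF finite_graph_join[OF assms]]] by blast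
  then show "F_number F G + F_number F H \<le> F_number F (graph_join G H)"
    using F_number_le add_mono le_trans by meson
qed

lemma F_number_disj:
  assumes "finite_graph G" "finite_graph H"
  shows "F_number F (disj_prod G H) \<le> F_number F G * F_number F H"
  using assms by (intro F_number_le disj_hom_F hom_F_number)

lemma F_number_lex_le_disj:
  assumes "finite_graph G" "finite_graph H"
  shows "F_number F (lex_prod_graph G H) \<le> F_number F (disj_prod G H)"
  using assms by (intro F_number_mono finite_graph_disj lex_hom_disj)

lemma F_number_complete: "F_number F (complete_graph n) = n"
  using F_number_le[OF complete_hom_F, of n] hom_F_number[OF finite_graph_complete, of n]
    complete_hom_F_iff by (simp add: antisym)

text \<open>The flat spanned by the image of each fibre \<open>{g} \<times> H\<close> receives \<open>H\<close>, so its rank is at least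
  the \<open>F\<close>-number of \<open>H\<close>, and flats over adjacent vertices are orthogonal.\<close>

lemma lex_hom_F:
  assumes "lex_prod_graph G H \<rightarrow>\<^sub>g F n"
  shows "lex_prod_graph G (complete_graph (F_number F H)) \<rightarrow>\<^sub>g F n"
proof -
  let ?m = "F_number F H"
  obtain f where f: "graph_hom (lex_prod_graph G H) (F n) f"
    using assms unfolding hom_to_def by blast
  define A where "A g = (\<lambda>h. f (g, h)) ` verts H" for g
  define S where "S g = perp (F n) (perp (F n) (A g))" for g
  have A: "A g \<subseteq> verts (F n)" if "g \<in> verts G" for g
    using that graph_homD(1)[OF f] unfolding A_def by auto
  have hom: "adj (F n) (f (g, h)) (f (g', h'))"
    if "g \<in> verts G" "g' \<in> verts G" "h \<in> verts H" "h' \<in> verts H" "adj G g g' \<or> g = g' \<and> adj H h h'"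
    for g g' h h'
    using that by (intro graph_homD(2)[OF f]) simp_all
  have "\<exists>C \<subseteq> S g. is_clique (F n) ?m C" if g: "g \<in> verts G" for g
  proof -
    have "graph_hom H (F n) (\<lambda>h. f (g, h))"
      using A[OF g] hom g unfolding graph_hom_def A_def by auto
    moreover have "(\<lambda>h. f (g, h)) ` verts H \<subseteq> S g"
      using subset_perp_perp[OF simple_F A[OF g]] unfolding S_def A_def .
    ultimately have H: "H \<rightarrow>\<^sub>g induced (F n) (S g)" by (rule hom_induced_image)
    have "is_flat (F n) (S g)" unfolding S_def by (intro is_flat_perp simple_F perp_subset_verts)
    then obtain r R where r: "induced (F n) (S g) \<rightarrow>\<^sub>g F r" "R \<subseteq> S g" "is_clique (F n) r R"
      by (rule flatE) blast
    have "?m \<le> r" by (rule F_number_le[OF hom_to_trans[OF H r(1)]])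
    \<comment> \<open>The rank \<open>r\<close> may vary with \<open>g\<close>. Minimality of the
      \<open>F\<close>-number makes \<open>?m\<close> a lower bound for all these ranks, so
      subcliques of one common size exist.\<close>
    then obtain C where C: "C \<subseteq> R" "card C = ?m"
      using r(3) unfolding is_clique_def by (metis obtain_subset_with_card_n)
    then show ?thesis using r(2) is_clique_mono[OF r(3) C(1)] by (intro exI[of _ C]) auto
  qed
  then obtain C where C: "\<And>g. g \<in> verts G \<Longrightarrow> C g \<subseteq> S g"
    "\<And>g. g \<in> verts G \<Longrightarrow> is_clique (F n) ?m (C g)" by metis
  have adjC: "adj (F n) s t"
    if g: "g \<in> verts G" "g' \<in> verts G" "adj G g g'" and "s \<in> C g" "t \<in> C g'" for g g' s t
  proof -
    \<comment> \<open>Orthogonality of the images extends to their spans: applying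
      \<open>perp\<close> to this inclusion places \<open>S g'\<close> inside
      \<open>perp (F n) (A g)\<close>, whose perp is \<open>S g\<close>.\<close>
    have "A g \<subseteq> perp (F n) (A g')"
      using A[OF g(1)] hom g unfolding A_def perp_def by auto
    then have "S g' \<subseteq> perp (F n) (A g)" unfolding S_def by (rule perp_antimono)
    then have "C g' \<subseteq> perp (F n) (A g)" using C(1)[OF g(2)] by simp
    moreover have "C g \<subseteq> perp (F n) (perp (F n) (A g))" using C(1)[OF g(1)] unfolding S_def .
    ultimately show ?thesis using that(4,5) by (intro adj_perp[of s _ "perp (F n) (A g)"]) auto
  qed
  have "G \<rightarrow>\<^sub>g fractionalization (F n) ?m"
  proof (rule hom_toI[of _ C], goal_cases)
    case (1 v)
    then show ?case using C(2) by (simp add: fractionalization_def)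
  next
    case (2 v w)
    then have vw: "\<forall>s\<in>C v. \<forall>t\<in>C w. adj (F n) s t" using adjC by auto
    then have "C v \<inter> C w = {}" using simple_graphD(3)[OF simple_F] by blast
    then show ?case using 2 C(2) vw by (simp add: fractionalization_def)
  qed
  then show ?thesis using hom_fractionalization_iff[OF simple_F] by blast
qed

subsection \<open>The fractional number\<close>

definition frac_bounds :: "'b ugraph \<Rightarrow> real set" where
  "frac_bounds G = {real n / real d | n d. d > 0 \<and> lex_prod_graph G (complete_graph d) \<rightarrow>\<^sub>g F n}"

lemma frac_F_number_eq: "frac_F_number F G = Inf (frac_bounds G)"
  unfolding frac_F_number_def frac_bounds_def hom_fractionalization_iff[OF simple_F] ..

lemma frac_bounds_nonneg: "x \<in> frac_bounds G \<Longrightarrow> 0 \<le> x"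
  unfolding frac_bounds_def by auto

lemma frac_le:
  assumes "d > 0" "lex_prod_graph G (complete_graph d) \<rightarrow>\<^sub>g F n"
  shows "frac_F_number F G \<le> real n / real d"
  unfolding frac_F_number_eq
  by (rule cInf_lower)
    (use assms in \<open>auto simp: frac_bounds_def intro!: bdd_belowI2 bdd_belowI[of _ 0]\<close>)

text \<open>Denominator 1. Besides bounding the fractional number from above, this supplies the
  member without which the infimum of a set of reals carries no information.\<close>

lemma frac_bounds_F_number:
  assumes "finite_graph G"
  shows "real (F_number F G) \<in> frac_bounds G"
proof -
  have "lex_prod_graph G (complete_graph 1) \<rightarrow>\<^sub>g G" by (rule hom_toI[of _ fst]) auto
  then have "lex_prod_graph G (complete_graph 1) \<rightarrow>\<^sub>g F (F_number F G)"
    using hom_F_number[OF assms] by (rule hom_to_trans)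
  then show ?thesis unfolding frac_bounds_def
    by (intro CollectI exI[of _ "F_number F G"] exI[of _ 1]) simp
qed

lemma frac_bounds_nonempty: "finite_graph G \<Longrightarrow> frac_bounds G \<noteq> {}"
  using frac_bounds_F_number by blast

lemma frac_ge:
  assumes "finite_graph G"
    and "\<And>n d. d > 0 \<Longrightarrow> lex_prod_graph G (complete_graph d) \<rightarrow>\<^sub>g F n \<Longrightarrow> c \<le> real n / real d"
  shows "c \<le> frac_F_number F G"
  unfolding frac_F_number_eq
  by (rule cInf_greatest[OF frac_bounds_nonempty[OF assms(1)]])
    (use assms(2) in \<open>auto simp: frac_bounds_def\<close>)

lemma frac_nonneg: "finite_graph G \<Longrightarrow> 0 \<le> frac_F_number F G"
  by (rule frac_ge) auto

lemma frac_le_F_number: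
  assumes "finite_graph G"
  shows "frac_F_number F G \<le> real (F_number F G)"
  unfolding frac_F_number_eq
  by (rule cInf_lower[OF frac_bounds_F_number[OF assms]])
    (auto intro: bdd_belowI[of _ 0] frac_bounds_nonneg)

lemma frac_mono:
  assumes "finite_graph H" "G \<rightarrow>\<^sub>g H"
  shows "frac_F_number F G \<le> frac_F_number F H"
  by (intro frac_ge[OF assms(1)] frac_le) (auto intro: hom_to_trans[OF lex_prod_mono_left[OF assms(2)]])

text \<open>Expanding a fraction by \<open>e\<close>, obtained as its product with
  \<open>e / e\<close> for the one-vertex graph. It brings two fractions to a common
  denominator.\<close>

lemma lex_complete_scale:
  assumes "lex_prod_graph G (complete_graph d) \<rightarrow>\<^sub>g F n"
  shows "lex_prod_graph G (complete_graph (d * e)) \<rightarrow>\<^sub>g F (n * e)"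
proof -
  have "lex_prod_graph G (complete_graph (d * e)) \<rightarrow>\<^sub>g
      lex_prod_graph (disj_prod G (complete_graph 1)) (complete_graph (d * e))"
    by (intro lex_prod_mono_left hom_toI[of _ "\<lambda>v. (v, 0)"]) auto
  moreover have "lex_prod_graph (complete_graph 1) (complete_graph e) \<rightarrow>\<^sub>g complete_graph e"
    by (rule hom_toI[of _ snd]) auto
  then have "lex_prod_graph (complete_graph 1) (complete_graph e) \<rightarrow>\<^sub>g F e"
    using complete_hom_F by (rule hom_to_trans)
  ultimately show ?thesis
    using disj_hom_F[OF assms] by (meson disj_prod_lex_complete hom_to_trans)
qed

lemma frac_join:
  assumes fin: "finite_graph G" "finite_graph H"
  shows "frac_F_number F (graph_join G H) = frac_F_number F G + frac_F_number F H"
proof (rule antisym)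
  have "frac_F_number F (graph_join G H) \<le> x + y"
    if "x \<in> frac_bounds G" "y \<in> frac_bounds H" for x y
  proof -
    obtain n d where x: "x = real n / real d" "d > 0" "lex_prod_graph G (complete_graph d) \<rightarrow>\<^sub>g F n"
      using \<open>x \<in> _\<close> unfolding frac_bounds_def by blast
    obtain m e where y: "y = real m / real e" "e > 0" "lex_prod_graph H (complete_graph e) \<rightarrow>\<^sub>g F m"
      using \<open>y \<in> _\<close> unfolding frac_bounds_def by blast
    \<comment> \<open>Over the common denominator \<open>d * e\<close> the numerators are
      \<open>n * e\<close> and \<open>m * d\<close>, and a join adds them.\<close>
    have "graph_join (lex_prod_graph G (complete_graph (d * e))) (lex_prod_graph H (complete_graph (d * e)))
        \<rightarrow>\<^sub>g F (n * e + m * d)"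
      using lex_complete_scale[OF x(3), of e] lex_complete_scale[OF y(3), of d]
      by (intro join_hom_F) (simp_all add: mult.commute)
    then have "lex_prod_graph (graph_join G H) (complete_graph (d * e)) \<rightarrow>\<^sub>g F (n * e + m * d)"
      by (rule hom_to_trans[OF lex_join])
    then have "frac_F_number F (graph_join G H) \<le> real (n * e + m * d) / real (d * e)"
      using x(2) y(2) by (intro frac_le) auto
    also have "\<dots> = x + y" unfolding x(1) y(1) using x(2) y(2) by (simp add: field_simps)
    finally show ?thesis .
  qed
  then show "frac_F_number F (graph_join G H) \<le> frac_F_number F G + frac_F_number F H"
    unfolding frac_F_number_eq[of G] frac_F_number_eq[of H]
    by (intro le_Inf_add_Inf frac_bounds_nonempty fin)
  show "frac_F_number F G + frac_F_number F H \<le> frac_F_number F (graph_join G H)"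
  proof (rule frac_ge[OF finite_graph_join[OF fin]])
    fix n d :: nat
    assume d: "d > 0" and "lex_prod_graph (graph_join G H) (complete_graph d) \<rightarrow>\<^sub>g F n"
    then obtain r s where rs: "r + s \<le> n" "lex_prod_graph G (complete_graph d) \<rightarrow>\<^sub>g F r"
      "lex_prod_graph H (complete_graph d) \<rightarrow>\<^sub>g F s"
      using join_hom_F_split[OF hom_to_trans[OF join_lex]] by blast
    have "frac_F_number F G + frac_F_number F H \<le> real r / real d + real s / real d"
      using d rs by (intro add_mono frac_le)
    also have "\<dots> = real (r + s) / real d" by (simp add: add_divide_distrib)
    also have "\<dots> \<le> real n / real d" using rs(1) by (intro divide_right_mono) auto
    finally show "frac_F_number F G + frac_F_number F H \<le> real n / real d" .
  qed
qed

lemma frac_disj_le: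
  assumes fin: "finite_graph G" "finite_graph H"
  shows "frac_F_number F (disj_prod G H) \<le> frac_F_number F G * frac_F_number F H"
proof -
  have "frac_F_number F (disj_prod G H) \<le> x * y"
    if "x \<in> frac_bounds G" "y \<in> frac_bounds H" for x y
  proof -
    obtain n d where x: "x = real n / real d" "d > 0" "lex_prod_graph G (complete_graph d) \<rightarrow>\<^sub>g F n"
      using \<open>x \<in> _\<close> unfolding frac_bounds_def by blast
    obtain m e where y: "y = real m / real e" "e > 0" "lex_prod_graph H (complete_graph e) \<rightarrow>\<^sub>g F m"
      using \<open>y \<in> _\<close> unfolding frac_bounds_def by blast
    have "lex_prod_graph (disj_prod G H) (complete_graph (d * e)) \<rightarrow>\<^sub>g F (n * m)"
      using disj_prod_lex_complete disj_hom_F[OF x(3) y(3)] by (rule hom_to_trans)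
    then have "frac_F_number F (disj_prod G H) \<le> real (n * m) / real (d * e)"
      using x(2) y(2) by (intro frac_le) auto
    then show ?thesis unfolding x(1) y(1) by simp
  qed
  then show ?thesis
    unfolding frac_F_number_eq[of G] frac_F_number_eq[of H]
    by (intro le_Inf_mult_Inf frac_bounds_nonempty frac_bounds_nonneg fin)
qed

text \<open>Associating the product the other way exhibits \<open>n / d\<close> as
  \<open>(n / m) * (m / d)\<close>, where \<open>m\<close> is the \<open>F\<close>-number of the
  lexicographic product of \<open>H\<close> with \<open>K_d\<close>: the first factor is admissible
  for \<open>G\<close>, the second for \<open>H\<close>.\<close>

lemma frac_lex_ge:
  assumes fin: "finite_graph G" "finite_graph H"
  shows "frac_F_number F G * frac_F_number F H \<le> frac_F_number F (lex_prod_graph G H)"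
proof (rule frac_ge[OF finite_graph_lex[OF fin]])
  fix n d :: nat
  assume d: "d > 0" and h: "lex_prod_graph (lex_prod_graph G H) (complete_graph d) \<rightarrow>\<^sub>g F n"
  define m where "m = F_number F (lex_prod_graph H (complete_graph d))"
  have G: "lex_prod_graph G (complete_graph m) \<rightarrow>\<^sub>g F n"
    unfolding m_def by (rule lex_hom_F[OF hom_to_trans[OF lex_assoc h]])
  have "lex_prod_graph H (complete_graph d) \<rightarrow>\<^sub>g F m"
    unfolding m_def by (intro hom_F_number finite_graph_lex finite_graph_complete fin)
  then have H: "frac_F_number F H \<le> real m / real d" using d by (rule frac_le[rotated])
  show "frac_F_number F G * frac_F_number F H \<le> real n / real d"
  \<comment> \<open>For \<open>m = 0\<close> there is no fraction \<open>n / m\<close>, but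
    \<open>m / d\<close> already forces the fractional number of \<open>H\<close> to vanish.\<close>
  proof (cases "m = 0")
    case True
    then have "frac_F_number F H = 0" using H frac_nonneg[OF fin(2)] by simp
    then show ?thesis by simp
  next
    case False
    then have "frac_F_number F G \<le> real n / real m" using G by (intro frac_le) auto
    then have "frac_F_number F G * frac_F_number F H \<le> (real n / real m) * (real m / real d)"
      using H frac_nonneg[OF fin(2)] by (intro mult_mono) auto
    then show ?thesis using False by simp
  qed
qed

text \<open>The inequalities close up: the product of the fractional numbers is at most the
  lexicographic value, which is at most the disjunctive value, which is at most the product
  again.\<close>

lemma frac_lex_disj:
  assumes fin: "finite_graph G" "finite_graph H"
  shows "frac_F_number F (lex_prod_graph G H) = frac_F_number F G * frac_F_number F H"
    and "frac_F_number F (disj_prod G H) = frac_F_number F G * frac_F_number F H"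
  using frac_mono[OF finite_graph_disj[OF fin] lex_hom_disj] frac_disj_le[OF fin] frac_lex_ge[OF fin]
  by auto

lemma frac_complete: "frac_F_number F (complete_graph n) = real n"
proof (rule antisym)
  show "frac_F_number F (complete_graph n) \<le> real n"
    using frac_le_F_number[OF finite_graph_complete, of n] by (simp add: F_number_complete)
  show "real n \<le> frac_F_number F (complete_graph n)"
  proof (rule frac_ge[OF finite_graph_complete])
    fix m d :: nat
    assume "d > 0" and h: "lex_prod_graph (complete_graph n) (complete_graph d) \<rightarrow>\<^sub>g F m"
    have "n * d \<le> m"
      using hom_to_trans[OF complete_graph_lex h] complete_hom_F_iff by blast
    then have "real n * real d \<le> real m" by (metis of_nat_le_iff of_nat_mult)
    then show "real n \<le> real m / real d" using \<open>d > 0\<close> by (simp add: field_simps)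
  qed
qed

lemma frac_iso:
  assumes "finite_graph G" "finite_graph H" "graph_iso G H"
  shows "frac_F_number F G = frac_F_number F H"
  using assms frac_mono graph_iso_imp_hom by (metis antisym)

lemma frac_semiring_homomorphic: "semiring_homomorphic (frac_F_number F)"
  unfolding semiring_homomorphic_def
proof (intro conjI allI impI; (elim conjE)?)
  fix G H J :: "nat ugraph"
  assume fin: "finite_graph G" "finite_graph H" "finite_graph J"
  show "frac_F_number F J = frac_F_number F G + frac_F_number F H" if "graph_iso J (graph_join G H)"
    using frac_iso[OF fin(3) finite_graph_join[OF fin(1,2)] that] frac_join[OF fin(1,2)] by simp
  show "frac_F_number F J = frac_F_number F G * frac_F_number F H" if "graph_iso J (disj_prod G H)"
    using frac_iso[OF fin(3) finite_graph_disj[OF fin(1,2)] that] frac_lex_disj(2)[OF fin(1,2)] by simp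
qed (use frac_nonneg frac_iso frac_mono frac_complete[of 1] in auto)

lemma frac_power:
  assumes "finite_graph G"
  shows "frac_F_number F G ^ n \<le> frac_F_number F (disj_power G n)"
proof (induction n)
  case 0
  then show ?case
    using frac_mono[OF finite_graph_power[OF assms] disj_power_0(2)] frac_complete[of 1] by simp
next
  case (Suc n)
  have "frac_F_number F G ^ Suc n \<le> frac_F_number F G * frac_F_number F (disj_power G n)"
    using Suc frac_nonneg[OF assms] by (simp add: mult_left_mono)
  also have "\<dots> = frac_F_number F (disj_prod G (disj_power G n))"
    using assms finite_graph_power by (intro frac_lex_disj(2)[symmetric]) auto
  also have "\<dots> \<le> frac_F_number F (disj_power G (Suc n))"
    using assms by (intro frac_mono finite_graph_power disj_power_Suc_inv)
  finally show ?case .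
qed

subsection \<open>The asymptotic number\<close>

lemma asymp_le: "n \<ge> 1 \<Longrightarrow> asymp_F_number F G \<le> root n (real (F_number F (disj_power G n)))"
  unfolding asymp_F_number_def
  by (rule cINF_lower) (auto intro!: bdd_belowI2[of _ 0])

lemma asymp_ge:
  "(\<And>n. n \<ge> 1 \<Longrightarrow> c \<le> root n (real (F_number F (disj_power G n)))) \<Longrightarrow> c \<le> asymp_F_number F G"
  unfolding asymp_F_number_def by (rule cINF_greatest) auto

lemma frac_le_asymp:
  assumes "finite_graph G"
  shows "frac_F_number F G \<le> asymp_F_number F G"
proof (rule asymp_ge)
  fix n :: nat assume "n \<ge> 1"
  have "frac_F_number F G ^ n \<le> real (F_number F (disj_power G n))"
    using frac_power[OF assms] frac_le_F_number[OF finite_graph_power[OF assms]] by (rule order_trans)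
  then have "root n (frac_F_number F G ^ n) \<le> root n (real (F_number F (disj_power G n)))"
    using \<open>n \<ge> 1\<close> by simp
  then show "frac_F_number F G \<le> root n (real (F_number F (disj_power G n)))"
    using \<open>n \<ge> 1\<close> frac_nonneg[OF assms] by (simp add: real_root_power_cancel)
qed

lemma asymp_le_F_number:
  assumes "finite_graph G"
  shows "asymp_F_number F G \<le> real (F_number F G)"
  using asymp_le[of 1 G] F_number_mono[OF assms disj_power_1] by simp

text \<open>The asymptotic number lies between two invariants that already agree on complete
  graphs.\<close>

lemma asymp_complete: "asymp_F_number F (complete_graph n) = real n"
  using frac_le_asymp[OF finite_graph_complete, of n] asymp_le_F_number[OF finite_graph_complete, of n]
  by (simp add: frac_complete F_number_complete)

lemma asymp_mono:
  assumes "finite_graph H" "G \<rightarrow>\<^sub>g H"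
  shows "asymp_F_number F G \<le> asymp_F_number F H"
proof (rule asymp_ge)
  fix n :: nat assume "n \<ge> 1"
  have "F_number F (disj_power G n) \<le> F_number F (disj_power H n)"
    using assms by (intro F_number_mono finite_graph_power disj_power_mono)
  then show "asymp_F_number F G \<le> root n (real (F_number F (disj_power H n)))"
    using asymp_le[OF \<open>n \<ge> 1\<close>, of G] \<open>n \<ge> 1\<close>
    by (meson of_nat_le_iff order_trans real_root_le_mono less_le_trans zero_less_one)
qed

section \<open>Growth of the integral number along powers\<close>

lemma F_number_power_add:
  assumes "finite_graph G"
  shows "F_number F (disj_power G (m + n)) \<le> F_number F (disj_power G m) * F_number F (disj_power G n)"
  by (rule order_trans[OF F_number_mono[OF _ disj_power_add] F_number_disj])
    (intro finite_graph_disj finite_graph_power assms)+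

lemma F_number_power_0: "F_number F (disj_power G 0) \<le> 1"
  using F_number_mono[OF finite_graph_complete disj_power_0(1)] by (simp add: F_number_complete)

lemma F_number_power_mult:
  assumes "finite_graph G"
  shows "F_number F (disj_power G (n * m)) \<le> F_number F (disj_power G n) ^ m"
proof (induction m)
  case 0
  then show ?case using F_number_power_0 by simp
next
  case (Suc m)
  have "F_number F (disj_power G (n * Suc m)) \<le> F_number F (disj_power G n) * F_number F (disj_power G (n * m))"
    using F_number_power_add[OF assms, of n "n * m"] by simp
  also have "\<dots> \<le> F_number F (disj_power G n) ^ Suc m" using Suc by simp
  finally show ?case .
qed

text \<open>The two infima range over independent exponents \<open>n\<close> and \<open>m\<close>.
  Both bounds are evaluated at the common exponent \<open>n * m\<close>, and the root of order
  \<open>n * m\<close> is split into iterated roots to recover each factor.\<close>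

lemma asymp_disj:
  assumes fin: "finite_graph G" "finite_graph H"
  shows "asymp_F_number F (disj_prod G H) \<le> asymp_F_number F G * asymp_F_number F H"
proof -
  let ?a = "\<lambda>n. real (F_number F (disj_power G n))"
  let ?b = "\<lambda>n. real (F_number F (disj_power H n))"
  have "asymp_F_number F (disj_prod G H) \<le> root n (?a n) * root m (?b m)"
    if nm: "n \<ge> 1" "m \<ge> 1" for n m
  proof -
    have "F_number F (disj_power (disj_prod G H) (n * m)) \<le>
        F_number F (disj_power G (n * m)) * F_number F (disj_power H (n * m))"
      by (rule order_trans[OF F_number_mono[OF _ disj_power_disj_prod] F_number_disj])
        (intro finite_graph_disj finite_graph_power fin)+
    also have "\<dots> \<le> F_number F (disj_power G n) ^ m * F_number F (disj_power H m) ^ n"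
      using F_number_power_mult[OF fin(1), of n m] F_number_power_mult[OF fin(2), of m n]
      by (intro mult_mono) (simp_all add: mult.commute)
    finally have "real (F_number F (disj_power (disj_prod G H) (n * m))) \<le> ?a n ^ m * ?b m ^ n"
      by (metis of_nat_le_iff of_nat_mult of_nat_power)
    then have "root (n * m) (real (F_number F (disj_power (disj_prod G H) (n * m))))
        \<le> root (n * m) (?a n ^ m * ?b m ^ n)"
      using nm by simp
    also have "\<dots> = root (n * m) (?a n ^ m) * root (m * n) (?b m ^ n)"
      by (simp only: real_root_mult mult.commute[of m n])
    also have "\<dots> = root n (root m (?a n ^ m)) * root m (root n (?b m ^ n))"
      by (simp only: real_root_mult_exp)
    also have "\<dots> = root n (?a n) * root m (?b m)"
      using nm by (simp add: real_root_power_cancel)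
    finally show ?thesis using asymp_le[of "n * m" "disj_prod G H"] nm by simp
  qed
  then show ?thesis
    unfolding asymp_F_number_def[of F G] asymp_F_number_def[of F H]
    by (intro le_Inf_mult_Inf) auto
qed

lemma F_number_power_growth:
  assumes fin: "finite_graph G" and x: "asymp_F_number F G < x"
  shows "\<exists>C>0. \<forall>k. real (F_number F (disj_power G k)) \<le> C * x ^ k"
proof -
  let ?a = "\<lambda>n. real (F_number F (disj_power G n))"
  obtain p where p: "p \<ge> 1" "root p (?a p) < x"
    using x asymp_ge[of x G] by (meson not_le)
  have xpos: "x > 0" using p(2) by (meson le_less_trans of_nat_0_le_iff real_root_ge_zero)
  have "?a p = root p (?a p) ^ p" using p(1) by (simp add: real_root_pow_pos2)
  also have "\<dots> \<le> x ^ p" using p by (intro power_mono) auto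
  finally show ?thesis
    using F_number_power_add[OF fin] p(1) xpos
    by (intro submultiplicative_growth[of ?a p]) (auto simp flip: of_nat_mult)
qed

text \<open>Splitting off one factor \<open>G + H\<close> at a time replaces the binomial expansion of \<open>(G + H)\<^sup>n\<close>.\<close>

lemma F_number_power_join:
  assumes fin: "finite_graph G" "finite_graph H"
    and nonneg: "x \<ge> 0" "y \<ge> 0" "C \<ge> 0" "D \<ge> 0"
    and C: "\<And>k. real (F_number F (disj_power G k)) \<le> C * x ^ k"
    and D: "\<And>k. real (F_number F (disj_power H k)) \<le> D * y ^ k"
  shows "real (F_number F (disj_prod (disj_prod (disj_power G i) (disj_power H j))
      (disj_power (graph_join G H) n))) \<le> C * D * x ^ i * y ^ j * (x + y) ^ n"
\<comment> \<open>Each step moves one factor into the power of \<open>G\<close> or of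
  \<open>H\<close>, so the hypothesis is used at \<open>Suc i, j\<close> and at
  \<open>i, Suc j\<close>. The two bounds carry an additional factor \<open>x\<close> and
  \<open>y\<close> respectively, and these add up to one more \<open>x + y\<close>.\<close>
proof (induction n arbitrary: i j)
  case 0
  have "F_number F (disj_prod (disj_prod (disj_power G i) (disj_power H j)) (disj_power (graph_join G H) 0))
      \<le> F_number F (disj_prod (disj_power G i) (disj_power H j)) * F_number F (disj_power (graph_join G H) 0)"
    by (intro F_number_disj finite_graph_disj finite_graph_power finite_graph_join fin)
  also have "\<dots> \<le> F_number F (disj_prod (disj_power G i) (disj_power H j)) * 1"
    by (intro mult_left_mono F_number_power_0) simp
  also have "\<dots> \<le> F_number F (disj_power G i) * F_number F (disj_power H j)"
    by (simp add: F_number_disj finite_graph_power fin)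
  finally have "real (F_number F (disj_prod (disj_prod (disj_power G i) (disj_power H j))
      (disj_power (graph_join G H) 0))) \<le> real (F_number F (disj_power G i)) * real (F_number F (disj_power H j))"
    by (metis of_nat_le_iff of_nat_mult)
  also have "\<dots> \<le> (C * x ^ i) * (D * y ^ j)"
    using nonneg by (intro mult_mono C D) auto
  finally show ?case by (simp add: mult_ac)
next
  case (Suc n)
  let ?P = "\<lambda>i j. disj_prod (disj_prod (disj_power G i) (disj_power H j)) (disj_power (graph_join G H) n)"
  have finP: "finite_graph (?P i j)" for i j
    by (intro finite_graph_disj finite_graph_power finite_graph_join fin)
  have "F_number F (disj_prod (disj_prod (disj_power G i) (disj_power H j)) (disj_power (graph_join G H) (Suc n)))
      \<le> F_number F (graph_join (?P (Suc i) j) (?P i (Suc j)))"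
    by (intro F_number_mono finite_graph_join finP disj_power_join_Suc)
  also have "\<dots> = F_number F (?P (Suc i) j) + F_number F (?P i (Suc j))"
    by (intro F_number_join finP)
  finally have "real (F_number F (disj_prod (disj_prod (disj_power G i) (disj_power H j))
      (disj_power (graph_join G H) (Suc n)))) \<le> real (F_number F (?P (Suc i) j)) + real (F_number F (?P i (Suc j)))"
    by (metis of_nat_le_iff of_nat_add)
  also have "\<dots> \<le> C * D * x ^ Suc i * y ^ j * (x + y) ^ n + C * D * x ^ i * y ^ Suc j * (x + y) ^ n"
    by (intro add_mono Suc)
  also have "\<dots> = C * D * x ^ i * y ^ j * (x + y) ^ Suc n" by (simp add: algebra_simps)
  finally show ?case .
qed

lemma asymp_join:
  assumes fin: "finite_graph G" "finite_graph H"
  shows "asymp_F_number F (graph_join G H) \<le> asymp_F_number F G + asymp_F_number F H"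
proof (rule field_le_epsilon)
  fix e :: real assume "e > 0"
  \<comment> \<open>The growth bound needs a base strictly above the asymptotic number. Half of
    \<open>e\<close> goes to each side, which also makes both bases positive.\<close>
  define x where "x = asymp_F_number F G + e / 2"
  define y where "y = asymp_F_number F H + e / 2"
  have nonneg: "0 \<le> asymp_F_number F G" "0 \<le> asymp_F_number F H"
    by (auto intro: asymp_ge)
  have xy: "x > 0" "y > 0" using nonneg \<open>e > 0\<close> unfolding x_def y_def by auto
  obtain C where C: "C > 0" "\<And>k. real (F_number F (disj_power G k)) \<le> C * x ^ k"
    using F_number_power_growth[OF fin(1), of x] \<open>e > 0\<close> unfolding x_def by auto
  obtain D where D: "D > 0" "\<And>k. real (F_number F (disj_power H k)) \<le> D * y ^ k"
    using F_number_power_growth[OF fin(2), of y] \<open>e > 0\<close> unfolding y_def by auto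
  have bound: "asymp_F_number F (graph_join G H) \<le> root n (C * D) * (x + y)" if n: "n \<ge> 1" for n
  proof -
    let ?J = "disj_power (graph_join G H) n"
    \<comment> \<open>The expansion starts with both accumulators empty.\<close>
    have "?J \<rightarrow>\<^sub>g disj_prod (disj_prod (disj_power G 0) (disj_power H 0)) ?J"
      by (rule hom_toI[of _ "\<lambda>zs. (([], []), zs)"]) auto
    then have "F_number F ?J \<le> F_number F (disj_prod (disj_prod (disj_power G 0) (disj_power H 0)) ?J)"
      by (intro F_number_mono finite_graph_disj finite_graph_power finite_graph_join fin)
    then have "real (F_number F ?J) \<le> C * D * x ^ 0 * y ^ 0 * (x + y) ^ n"
      using F_number_power_join[OF fin _ _ _ _ C(2) D(2), of 0 0 n] C(1) D(1) xy by force
    then have "root n (real (F_number F ?J)) \<le> root n (C * D * (x + y) ^ n)"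
      using n by simp
    also have "\<dots> = root n (C * D) * (x + y)"
      using n xy by (simp add: real_root_mult real_root_power_cancel)
    finally show ?thesis using asymp_le[OF n] order_trans by blast
  qed
  \<comment> \<open>The bound holds for every \<open>n \<ge> 1\<close> with the same positive
    constant \<open>C * D\<close>, whose \<open>n\<close>-th roots tend to 1.\<close>
  have "(\<lambda>n. root n (C * D) * (x + y)) \<longlonglongrightarrow> 1 * (x + y)"
    using C(1) D(1) by (intro tendsto_mult LIMSEQ_root_const tendsto_const) simp
  then have "asymp_F_number F (graph_join G H) \<le> 1 * (x + y)"
    using bound by (intro LIMSEQ_le_const) blast+
  then show "asymp_F_number F (graph_join G H) \<le> asymp_F_number F G + asymp_F_number F H + e"
    unfolding x_def y_def by simp
qed

end

theorem theorem4p15: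
  fixes F :: "nat \<Rightarrow> 'f ugraph"
  assumes "semiring_family F" and "linear_like F"
  shows "((\<forall>(G::'a ugraph) (H::'b ugraph). finite_graph G \<and> finite_graph H \<longrightarrow>
        (G \<rightarrow>\<^sub>g H \<longrightarrow> F_number F G \<le> F_number F H) \<and>
        F_number F (graph_join G H) \<le> F_number F G + F_number F H \<and>
        F_number F (lex_prod_graph G H) \<le> F_number F G * F_number F H \<and>
        F_number F (disj_prod G H) \<le> F_number F G * F_number F H)
     \<and> (\<forall>(G::'a ugraph) (H::'b ugraph). finite_graph G \<and> finite_graph H \<longrightarrow>
        (G \<rightarrow>\<^sub>g H \<longrightarrow> frac_F_number F G \<le> frac_F_number F H) \<and>
        frac_F_number F (graph_join G H) \<le> frac_F_number F G + frac_F_number F H \<and>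
        frac_F_number F (lex_prod_graph G H) \<le> frac_F_number F G * frac_F_number F H \<and>
        frac_F_number F (disj_prod G H) \<le> frac_F_number F G * frac_F_number F H)
     \<and> (\<forall>(G::'a ugraph) (H::'b ugraph). finite_graph G \<and> finite_graph H \<longrightarrow>
        (G \<rightarrow>\<^sub>g H \<longrightarrow> asymp_F_number F G \<le> asymp_F_number F H) \<and>
        asymp_F_number F (graph_join G H) \<le> asymp_F_number F G + asymp_F_number F H \<and>
        asymp_F_number F (lex_prod_graph G H) \<le> asymp_F_number F G * asymp_F_number F H \<and>
        asymp_F_number F (disj_prod G H) \<le> asymp_F_number F G * asymp_F_number F H))
    \<and> (\<forall>(G::'a ugraph) (H::'b ugraph). finite_graph G \<and> finite_graph H \<longrightarrow>
        F_number F (graph_join G H) = F_number F G + F_number F H)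
    \<and> ((\<forall>(G::'a ugraph) (H::'b ugraph). finite_graph G \<and> finite_graph H \<longrightarrow>
        frac_F_number F (graph_join G H) = frac_F_number F G + frac_F_number F H \<and>
        frac_F_number F (lex_prod_graph G H) = frac_F_number F G * frac_F_number F H \<and>
        frac_F_number F (disj_prod G H) = frac_F_number F G * frac_F_number F H)
     \<and> semiring_homomorphic (frac_F_number F))
    \<and> (\<forall>G::'a ugraph. finite_graph G \<longrightarrow>
        frac_F_number F G \<le> asymp_F_number F G \<and> asymp_F_number F G \<le> real (F_number F G))
    \<and> (\<forall>n. F_number F (complete_graph n) = n \<and>
        frac_F_number F (complete_graph n) = real n \<and>
        asymp_F_number F (complete_graph n) = real n)"
proof -
  interpret linear_like_family F using assms by unfold_locales
  have lex_F: "F_number F (lex_prod_graph G H) \<le> F_number F G * F_number F H"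
    if "finite_graph G" "finite_graph H" for G :: "'a ugraph" and H :: "'b ugraph"
    using F_number_lex_le_disj[OF that] F_number_disj[OF that] by simp
  have lex_asymp: "asymp_F_number F (lex_prod_graph G H) \<le> asymp_F_number F G * asymp_F_number F H"
    if "finite_graph G" "finite_graph H" for G :: "'a ugraph" and H :: "'b ugraph"
    using asymp_mono[OF finite_graph_disj[OF that] lex_hom_disj] asymp_disj[OF that] by simp
  show ?thesis
    by (intro conjI allI impI; (elim conjE)?;
      (rule F_number_join F_number_join[THEN eq_refl] F_number_disj lex_F
        frac_join frac_join[THEN eq_refl] frac_lex_disj frac_lex_disj[THEN eq_refl]
        asymp_join asymp_disj lex_asymp F_number_mono frac_mono asymp_mono
        frac_semiring_homomorphic frac_le_asymp asymp_le_F_number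
        F_number_complete frac_complete asymp_complete; assumption))
qed

end
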